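(* For every $p>1$, the assumption $\sup_{r\ge1}\frac1r\tau(T^{p+\frac1r})<\infty$ does not guarantee $T\in\mathcal L^{(p,\infty)}$; that is, for every $p>1$ there exist a semifinite von Neumann algebra $\mathcal N$ with a faithful normal semifinite trace $\tau$ and a positive $T\in\mathcal N$ such that $\sup_{r\ge1}\frac1r\tau(T^{p+\frac1r})<\infty$ but $T\notin\mathcal L^{(p,\infty)}(\mathcal N,\tau)$.
   Context: For $A\in\mathcal N$ and $t\ge0$, $\mu_t(A)=\inf\{s\ge 0:\tau(E^{|A|}(s,\infty))\le t\}$, where $E^{|A|}$ is the spectral measure of $|A|$. For $p>1$ let $\psi_p(t)=t$ for $0\le t\le1$ and $\psi_p(t)=t^{1-1/p}$ for $t\ge1$. Then $\mathcal L^{(p,\infty)}(\mathcal N,\tau)$ is the set of $A\in\mathcal N$ with $\sup_{t>0}\frac1{\psi_p(t)}\int_0^t\mu_s(A)\,ds<\infty$. *)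

theory Defs
  imports "HOL-Analysis.Analysis" "HOL-Algebra.Algebraic_Closure_Type"
begin

section \<open>Complex Hilbert spaces\<close>

text \<open>
  Hilbert spaces are records with an explicit carrier, so that one can quantify over all
  Hilbert spaces whose vectors have a given type.
\<close>

record 'a inner_product_space = "(complex, 'a) module" +
  ip :: "'a \<Rightarrow> 'a \<Rightarrow> complex"

definition hnorm :: "('a, 'm) inner_product_space_scheme \<Rightarrow> 'a \<Rightarrow> real" where
  "hnorm H x = sqrt (Re (ip H x x))"

locale hilbert_space =
  module "ring_of_type_algebra :: complex ring" H
  for H :: "('a, 'm) inner_product_space_scheme" (structure) +
  assumes ip_add_left:
      "\<lbrakk>x \<in> carrier H; y \<in> carrier H; z \<in> carrier H\<rbrakk>
        \<Longrightarrow> ip H (x \<oplus> y) z = ip H x z + ip H y z"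
    and ip_smult_left:
      "\<lbrakk>x \<in> carrier H; y \<in> carrier H\<rbrakk> \<Longrightarrow> ip H (c \<odot> x) y = c * ip H x y"
    and ip_cnj:
      "\<lbrakk>x \<in> carrier H; y \<in> carrier H\<rbrakk> \<Longrightarrow> ip H y x = cnj (ip H x y)"
    and ip_nonneg:
      "x \<in> carrier H \<Longrightarrow> ip H x x \<in> \<real>\<^sub>\<ge>\<^sub>0"
    and ip_eq_0:
      "\<lbrakk>x \<in> carrier H; ip H x x = 0\<rbrakk> \<Longrightarrow> x = \<zero>"
    and cauchy_complete:
      "\<lbrakk>\<And>n::nat. u n \<in> carrier H;
        \<And>e. e > 0 \<Longrightarrow> \<exists>M. \<forall>m\<ge>M. \<forall>n\<ge>M. hnorm H (u m \<ominus> u n) < e\<rbrakk>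
        \<Longrightarrow> \<exists>x\<in>carrier H. (\<lambda>n. hnorm H (u n \<ominus> x)) \<longlonglongrightarrow> 0"


section \<open>Bounded operators\<close>

text \<open>
  Operators are extensional functions on the carrier, so that equality of functions is
  equality of operators.  Products are \<^const>\<open>compose\<close> on the carrier.
\<close>

definition bounded_ops :: "('a, 'm) inner_product_space_scheme \<Rightarrow> ('a \<Rightarrow> 'a) set" where
  "bounded_ops H = {A \<in> carrier H \<rightarrow>\<^sub>E carrier H.
     (\<forall>x\<in>carrier H. \<forall>y\<in>carrier H. A (x \<oplus>\<^bsub>H\<^esub> y) = A x \<oplus>\<^bsub>H\<^esub> A y) \<and>
     (\<forall>c. \<forall>x\<in>carrier H. A (c \<odot>\<^bsub>H\<^esub> x) = c \<odot>\<^bsub>H\<^esub> A x) \<and>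
     (\<exists>C. \<forall>x\<in>carrier H. hnorm H (A x) \<le> C * hnorm H x)}"

definition op_id :: "('a, 'm) inner_product_space_scheme \<Rightarrow> 'a \<Rightarrow> 'a" where
  "op_id H = (\<lambda>x\<in>carrier H. x)"

definition op_zero :: "('a, 'm) inner_product_space_scheme \<Rightarrow> 'a \<Rightarrow> 'a" where
  "op_zero H = (\<lambda>x\<in>carrier H. \<zero>\<^bsub>H\<^esub>)"

definition op_add ::
    "('a, 'm) inner_product_space_scheme \<Rightarrow> ('a \<Rightarrow> 'a) \<Rightarrow> ('a \<Rightarrow> 'a) \<Rightarrow> 'a \<Rightarrow> 'a" where
  "op_add H A B = (\<lambda>x\<in>carrier H. A x \<oplus>\<^bsub>H\<^esub> B x)"

definition op_scale ::
    "('a, 'm) inner_product_space_scheme \<Rightarrow> complex \<Rightarrow> ('a \<Rightarrow> 'a) \<Rightarrow> 'a \<Rightarrow> 'a" where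
  "op_scale H c A = (\<lambda>x\<in>carrier H. c \<odot>\<^bsub>H\<^esub> A x)"

abbreviation op_mult ::
    "('a, 'm) inner_product_space_scheme \<Rightarrow> ('a \<Rightarrow> 'a) \<Rightarrow> ('a \<Rightarrow> 'a) \<Rightarrow> 'a \<Rightarrow> 'a" where
  "op_mult H \<equiv> compose (carrier H)"

definition adj :: "('a, 'm) inner_product_space_scheme \<Rightarrow> ('a \<Rightarrow> 'a) \<Rightarrow> 'a \<Rightarrow> 'a" where
  "adj H A = (THE B. B \<in> bounded_ops H \<and>
     (\<forall>x\<in>carrier H. \<forall>y\<in>carrier H. ip H (A x) y = ip H x (B y)))"

definition positive_ops :: "('a, 'm) inner_product_space_scheme \<Rightarrow> ('a \<Rightarrow> 'a) set" where
  "positive_ops H = {A \<in> bounded_ops H. \<forall>x\<in>carrier H. ip H (A x) x \<in> \<real>\<^sub>\<ge>\<^sub>0}"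

definition op_le ::
    "('a, 'm) inner_product_space_scheme \<Rightarrow> ('a \<Rightarrow> 'a) \<Rightarrow> ('a \<Rightarrow> 'a) \<Rightarrow> bool" where
  "op_le H A B \<longleftrightarrow> op_add H B (op_scale H (-1) A) \<in> positive_ops H"

definition projections :: "('a, 'm) inner_product_space_scheme \<Rightarrow> ('a \<Rightarrow> 'a) set" where
  "projections H = {P \<in> bounded_ops H. op_mult H P P = P \<and> adj H P = P}"


section \<open>Spectral measures and functional calculus\<close>

definition spectral_measure ::
    "('a, 'm) inner_product_space_scheme \<Rightarrow> (real set \<Rightarrow> 'a \<Rightarrow> 'a) \<Rightarrow> bool" where
  "spectral_measure H E \<longleftrightarrow>
     E \<in> sets borel \<rightarrow>\<^sub>E projections H \<and>
     E UNIV = op_id H \<and>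
     (\<forall>B\<in>sets borel. \<forall>C\<in>sets borel. E (B \<inter> C) = op_mult H (E B) (E C)) \<and>
     (\<forall>x\<in>carrier H. countably_additive (sets borel) (\<lambda>B. ennreal (Re (ip H (E B x) x))))"

definition scalar_measure ::
    "('a, 'm) inner_product_space_scheme \<Rightarrow> (real set \<Rightarrow> 'a \<Rightarrow> 'a) \<Rightarrow> 'a \<Rightarrow> real measure" where
  "scalar_measure H E x = measure_of UNIV (sets borel) (\<lambda>B. ennreal (Re (ip H (E B x) x)))"

text \<open>\<open>op_integral H E f B\<close> says that \<open>B = \<integral> f dE\<close> (weakly; by polarization the diagonal
  matrix elements suffice).\<close>

definition op_integral ::
    "('a, 'm) inner_product_space_scheme \<Rightarrow> (real set \<Rightarrow> 'a \<Rightarrow> 'a) \<Rightarrow> (real \<Rightarrow> real)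
      \<Rightarrow> ('a \<Rightarrow> 'a) \<Rightarrow> bool" where
  "op_integral H E f B \<longleftrightarrow> B \<in> bounded_ops H \<and>
     (\<forall>x\<in>carrier H. integrable (scalar_measure H E x) f \<and>
        ip H (B x) x = complex_of_real (\<integral>s. f s \<partial>scalar_measure H E x))"

definition spectral_measure_of ::
    "('a, 'm) inner_product_space_scheme \<Rightarrow> ('a \<Rightarrow> 'a) \<Rightarrow> real set \<Rightarrow> 'a \<Rightarrow> 'a" where
  "spectral_measure_of H A = (THE E. spectral_measure H E \<and> op_integral H E (\<lambda>s. s) A)"

definition op_fun ::
    "('a, 'm) inner_product_space_scheme \<Rightarrow> (real \<Rightarrow> real) \<Rightarrow> ('a \<Rightarrow> 'a) \<Rightarrow> 'a \<Rightarrow> 'a" where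
  "op_fun H f A = (THE B. op_integral H (spectral_measure_of H A) f B)"

text \<open>Only used for positive operators and positive exponents, so that \<open>0 powr a = 0\<close> is the
  right convention and negative arguments are irrelevant.\<close>

definition op_powr :: "('a, 'm) inner_product_space_scheme \<Rightarrow> ('a \<Rightarrow> 'a) \<Rightarrow> real \<Rightarrow> 'a \<Rightarrow> 'a" where
  "op_powr H A a = op_fun H (\<lambda>s. s powr a) A"

definition op_abs :: "('a, 'm) inner_product_space_scheme \<Rightarrow> ('a \<Rightarrow> 'a) \<Rightarrow> 'a \<Rightarrow> 'a" where
  "op_abs H A = op_powr H (op_mult H (adj H A) A) (1/2)"


section \<open>Von Neumann algebras and traces\<close>

definition commutant ::
    "('a, 'm) inner_product_space_scheme \<Rightarrow> ('a \<Rightarrow> 'a) set \<Rightarrow> ('a \<Rightarrow> 'a) set" where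
  "commutant H S = {B \<in> bounded_ops H. \<forall>A\<in>S. op_mult H A B = op_mult H B A}"

text \<open>A bicommutant is automatically a unital subalgebra.\<close>

definition von_neumann_algebra ::
    "('a, 'm) inner_product_space_scheme \<Rightarrow> ('a \<Rightarrow> 'a) set \<Rightarrow> bool" where
  "von_neumann_algebra H N \<longleftrightarrow>
     N \<subseteq> bounded_ops H \<and> (\<forall>A\<in>N. adj H A \<in> N) \<and> commutant H (commutant H N) = N"

definition pos_part ::
    "('a, 'm) inner_product_space_scheme \<Rightarrow> ('a \<Rightarrow> 'a) set \<Rightarrow> ('a \<Rightarrow> 'a) set" where
  "pos_part H N = N \<inter> positive_ops H"

text \<open>Traces are considered on the positive part of \<open>N\<close> only; their values elsewhere are
  irrelevant.\<close>

definition trace_on ::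
    "('a, 'm) inner_product_space_scheme \<Rightarrow> ('a \<Rightarrow> 'a) set \<Rightarrow> (('a \<Rightarrow> 'a) \<Rightarrow> ennreal) \<Rightarrow> bool" where
  "trace_on H N \<tau> \<longleftrightarrow>
     (\<forall>A\<in>pos_part H N. \<forall>B\<in>pos_part H N. \<tau> (op_add H A B) = \<tau> A + \<tau> B) \<and>
     (\<forall>c\<ge>0. \<forall>A\<in>pos_part H N. \<tau> (op_scale H (complex_of_real c) A) = ennreal c * \<tau> A) \<and>
     (\<forall>A\<in>N. \<tau> (op_mult H (adj H A) A) = \<tau> (op_mult H A (adj H A)))"

definition faithful_trace ::
    "('a, 'm) inner_product_space_scheme \<Rightarrow> ('a \<Rightarrow> 'a) set \<Rightarrow> (('a \<Rightarrow> 'a) \<Rightarrow> ennreal) \<Rightarrow> bool" where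
  "faithful_trace H N \<tau> \<longleftrightarrow> (\<forall>A\<in>pos_part H N. \<tau> A = 0 \<longrightarrow> A = op_zero H)"

definition op_directed ::
    "('a, 'm) inner_product_space_scheme \<Rightarrow> ('a \<Rightarrow> 'a) set \<Rightarrow> bool" where
  "op_directed H S \<longleftrightarrow>
     S \<noteq> {} \<and> (\<forall>A\<in>S. \<forall>B\<in>S. \<exists>C\<in>S. op_le H A C \<and> op_le H B C)"

definition is_sup_in ::
    "('a, 'm) inner_product_space_scheme \<Rightarrow> ('a \<Rightarrow> 'a) set \<Rightarrow> ('a \<Rightarrow> 'a) set \<Rightarrow> ('a \<Rightarrow> 'a) \<Rightarrow> bool"
  where
  "is_sup_in H N S A \<longleftrightarrow> A \<in> pos_part H N \<and> (\<forall>D\<in>S. op_le H D A) \<and>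
     (\<forall>B\<in>pos_part H N. (\<forall>D\<in>S. op_le H D B) \<longrightarrow> op_le H A B)"

definition normal_trace ::
    "('a, 'm) inner_product_space_scheme \<Rightarrow> ('a \<Rightarrow> 'a) set \<Rightarrow> (('a \<Rightarrow> 'a) \<Rightarrow> ennreal) \<Rightarrow> bool" where
  "normal_trace H N \<tau> \<longleftrightarrow>
     (\<forall>S A. S \<subseteq> pos_part H N \<and> op_directed H S \<and> is_sup_in H N S A \<longrightarrow> \<tau> A = (SUP D\<in>S. \<tau> D))"

definition semifinite_trace ::
    "('a, 'm) inner_product_space_scheme \<Rightarrow> ('a \<Rightarrow> 'a) set \<Rightarrow> (('a \<Rightarrow> 'a) \<Rightarrow> ennreal) \<Rightarrow> bool" where
  "semifinite_trace H N \<tau> \<longleftrightarrow>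
     (\<forall>A\<in>pos_part H N. A \<noteq> op_zero H \<longrightarrow>
        (\<exists>B\<in>pos_part H N. B \<noteq> op_zero H \<and> op_le H B A \<and> \<tau> B < \<infinity>))"

definition fns_trace ::
    "('a, 'm) inner_product_space_scheme \<Rightarrow> ('a \<Rightarrow> 'a) set \<Rightarrow> (('a \<Rightarrow> 'a) \<Rightarrow> ennreal) \<Rightarrow> bool" where
  "fns_trace H N \<tau> \<longleftrightarrow>
     trace_on H N \<tau> \<and> faithful_trace H N \<tau> \<and> normal_trace H N \<tau> \<and> semifinite_trace H N \<tau>"

definition semifinite_von_neumann_algebra ::
    "('a, 'm) inner_product_space_scheme \<Rightarrow> ('a \<Rightarrow> 'a) set \<Rightarrow> bool" where
  "semifinite_von_neumann_algebra H N \<longleftrightarrow>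
     von_neumann_algebra H N \<and> (\<exists>\<tau>. fns_trace H N \<tau>)"


section \<open>Singular numbers and weak Schatten ideals\<close>

definition singular_number ::
    "('a, 'm) inner_product_space_scheme \<Rightarrow> (('a \<Rightarrow> 'a) \<Rightarrow> ennreal) \<Rightarrow> ('a \<Rightarrow> 'a) \<Rightarrow> real \<Rightarrow> real"
  where
  "singular_number H \<tau> A t =
     Inf {s. 0 \<le> s \<and> \<tau> (spectral_measure_of H (op_abs H A) {s<..}) \<le> ennreal t}"

definition psi :: "real \<Rightarrow> real \<Rightarrow> real" where
  "psi p t = (if t \<le> 1 then t else t powr (1 - 1/p))"

definition weak_schatten ::
    "('a, 'm) inner_product_space_scheme \<Rightarrow> ('a \<Rightarrow> 'a) set \<Rightarrow> (('a \<Rightarrow> 'a) \<Rightarrow> ennreal) \<Rightarrow> real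
      \<Rightarrow> ('a \<Rightarrow> 'a) set" where
  "weak_schatten H N \<tau> p = {A \<in> N.
     (SUP t\<in>{0<..}. ennreal (1 / psi p t) *
        (\<integral>\<^sup>+s\<in>{0..t}. ennreal (singular_number H \<tau> A s) \<partial>lborel)) < \<infinity>}"

end

theory Submission
  imports Defs
begin

text \<open>
  The counterexample is commutative and discrete.  The algebra consists of the diagonal operators
  on \<open>\<ell>\<^sup>2\<close>, and the trace weights the \<open>k\<close>-th diagonal entry by \<open>w\<^sub>k > 0\<close>.  Because the weights are at our
  disposal, an eigenvalue \<open>\<lambda>\<^sub>k\<close> can be given any multiplicity, and a sparse sequence of eigenvalues
  suffices.

  Write \<open>\<lambda>\<^sub>k = exp (- x\<^sub>k)\<close> and \<open>w\<^sub>k = a\<^sub>k exp (p x\<^sub>k)\<close>.  Then \<open>\<tau> (T\<^bsup>p + \<epsilon>\<^esup>) = \<Sum>k. a\<^sub>k exp (- \<epsilon> x\<^sub>k)\<close>, and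
  \<open>exp (- y) \<le> 1 / y\<close> bounds this by \<open>(1 / \<epsilon>) \<Sum>k. a\<^sub>k / x\<^sub>k\<close>.  On the other hand
  \<open>\<mu>\<^sub>s \<ge> \<lambda>\<^sub>k\<close> for \<open>s < w\<^sub>k\<close>, so that the quotient defining \<open>\<L>\<^bsup>(p, \<infinity>)\<^esup>\<close> is at least
  \<open>w\<^sub>k \<lambda>\<^sub>k / w\<^sub>k\<^bsup>1 - 1/p\<^esup> = a\<^sub>k\<^bsup>1/p\<^esup>\<close> at \<open>t = w\<^sub>k\<close>.  Hence any choice with \<open>a\<^sub>k\<close> unbounded
  and \<open>\<Sum>k. a\<^sub>k / x\<^sub>k\<close> finite works; here \<open>a\<^sub>k = 2\<^sup>k\<close> and \<open>x\<^sub>k = 4\<^sup>k\<close>.  These two estimates are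
  \<open>trace_powr_le\<close> and \<open>not_weak_schatten\<close>.

  The remaining work is to see that the abstract notions take their expected values on diagonal
  operators.  The diagonal operators equal their own commutant (\<open>commutant_diag_algebra\<close>), the
  weighted sum of the diagonal is a faithful normal semifinite trace (\<open>fns_diag_trace\<close>), and the
  functional calculus acts entrywise.  Since the spectral measure of an operator is introduced by a
  definite description, the last point needs its uniqueness (\<open>spectral_measure_unique\<close>): a
  spectral measure representing a diagonal operator must be concentrated, at each unit vector, on
  the corresponding diagonal entry.
\<close>

section \<open>The Hilbert space of square-summable sequences\<close>

definition ell2 :: "(nat \<Rightarrow> complex) inner_product_space" where
  "ell2 = \<lparr>carrier = {x. summable (\<lambda>n. (cmod (x n))\<^sup>2)},
     monoid.mult = (\<lambda>x y n. x n * y n), one = (\<lambda>_. 1), zero = (\<lambda>_. 0), add = (\<lambda>x y n. x n + y n),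
     smult = (\<lambda>c x n. c * x n), ip = (\<lambda>x y. \<Sum>n. x n * cnj (y n))\<rparr>"

lemma mem_ell2_iff: "x \<in> carrier ell2 \<longleftrightarrow> summable (\<lambda>n. (cmod (x n))\<^sup>2)"
  by (simp add: ell2_def)

lemma ell2_simps [simp]:
  "x \<oplus>\<^bsub>ell2\<^esub> y = (\<lambda>n. x n + y n)"
  "\<zero>\<^bsub>ell2\<^esub> = (\<lambda>n. 0)"
  "c \<odot>\<^bsub>ell2\<^esub> x = (\<lambda>n. c * x n)"
  by (simp_all add: ell2_def)

lemma ip_ell2: "ip ell2 x y = (\<Sum>n. x n * cnj (y n))"
  by (simp add: ell2_def)

lemma ell2_zero [simp]: "(\<lambda>n. 0) \<in> carrier ell2"
  by (simp add: mem_ell2_iff)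

lemma ell2_smult [simp]: "x \<in> carrier ell2 \<Longrightarrow> (\<lambda>n. c * x n) \<in> carrier ell2"
  by (simp add: mem_ell2_iff norm_mult power_mult_distrib summable_mult)

lemma summable_norm_ip:
  assumes "x \<in> carrier ell2" "y \<in> carrier ell2"
  shows "summable (\<lambda>n. cmod (x n * cnj (y n)))"
proof (rule summable_comparison_test)
  show "\<exists>N. \<forall>n\<ge>N. norm (cmod (x n * cnj (y n))) \<le> (cmod (x n))\<^sup>2 + (cmod (y n))\<^sup>2"
  proof (intro exI allI impI)
    fix n
    have "0 \<le> (cmod (x n) - cmod (y n))\<^sup>2 + (cmod (x n))\<^sup>2 + (cmod (y n))\<^sup>2" by simp
    then show "norm (cmod (x n * cnj (y n))) \<le> (cmod (x n))\<^sup>2 + (cmod (y n))\<^sup>2"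
      by (simp add: norm_mult power2_diff)
  qed
  show "summable (\<lambda>n. (cmod (x n))\<^sup>2 + (cmod (y n))\<^sup>2)"
    using assms by (intro summable_add) (auto simp: mem_ell2_iff)
qed

lemma summable_ip:
  "x \<in> carrier ell2 \<Longrightarrow> y \<in> carrier ell2 \<Longrightarrow> summable (\<lambda>n. x n * cnj (y n))"
  by (rule summable_norm_cancel[OF summable_norm_ip])

lemma ell2_dominated:
  assumes "summable g" "\<And>n. (cmod (x n))\<^sup>2 \<le> g n"
  shows "x \<in> carrier ell2"
  unfolding mem_ell2_iff using assms
  by (intro summable_comparison_test[of "\<lambda>n. (cmod (x n))\<^sup>2" g]) auto

lemma cmod_add_sq: "(cmod (a + b))\<^sup>2 \<le> 2 * (cmod a)\<^sup>2 + 2 * (cmod b)\<^sup>2"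
proof -
  have "(cmod (a + b))\<^sup>2 \<le> (cmod a + cmod b)\<^sup>2"
    by (intro power_mono norm_triangle_ineq) auto
  also have "\<dots> \<le> 2 * (cmod a)\<^sup>2 + 2 * (cmod b)\<^sup>2"
    using zero_le_power2[of "cmod a - cmod b"] by (simp add: power2_sum power2_diff)
  finally show ?thesis .
qed

lemma ell2_add [simp]:
  assumes "x \<in> carrier ell2" "y \<in> carrier ell2"
  shows "(\<lambda>n. x n + y n) \<in> carrier ell2"
proof (rule ell2_dominated)
  show "summable (\<lambda>n. 2 * (cmod (x n))\<^sup>2 + 2 * (cmod (y n))\<^sup>2)"
    using assms unfolding mem_ell2_iff by (intro summable_add summable_mult)
qed (rule cmod_add_sq)

lemma ell2_diff [simp]:
  assumes "x \<in> carrier ell2" "y \<in> carrier ell2"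
  shows "(\<lambda>n. x n - y n) \<in> carrier ell2"
  using ell2_add[OF assms(1) ell2_smult[OF assms(2), of "-1"]] by simp

lemma ip_add_left_ell2:
  assumes "x \<in> carrier ell2" "y \<in> carrier ell2" "z \<in> carrier ell2"
  shows "ip ell2 (\<lambda>n. x n + y n) z = ip ell2 x z + ip ell2 y z"
  using suminf_add[OF summable_ip[OF assms(1,3)] summable_ip[OF assms(2,3)]]
  by (simp add: ip_ell2 distrib_right)

lemma ip_smult_left_ell2:
  assumes "x \<in> carrier ell2" "y \<in> carrier ell2"
  shows "ip ell2 (\<lambda>n. c * x n) y = c * ip ell2 x y"
  using suminf_mult[OF summable_ip[OF assms], of c] by (simp add: ip_ell2 mult.assoc)

lemma ip_cnj_ell2:
  assumes "x \<in> carrier ell2" "y \<in> carrier ell2"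
  shows "cnj (ip ell2 x y) = ip ell2 y x"
proof -
  have "(\<lambda>n. x n * cnj (y n)) sums ip ell2 x y"
    unfolding ip_ell2 using summable_ip[OF assms] by (rule summable_sums)
  then have "(\<lambda>n. cnj (x n * cnj (y n))) sums cnj (ip ell2 x y)"
    by (simp only: sums_cnj)
  then have "(\<lambda>n. y n * cnj (x n)) sums cnj (ip ell2 x y)" by (simp add: mult.commute)
  then show ?thesis unfolding ip_ell2 by (rule sums_unique)
qed

lemma ip_add_right_ell2:
  assumes "x \<in> carrier ell2" "y \<in> carrier ell2" "z \<in> carrier ell2"
  shows "ip ell2 z (\<lambda>n. x n + y n) = ip ell2 z x + ip ell2 z y"
  using arg_cong[OF ip_add_left_ell2[OF assms], of cnj] assms by (simp add: ip_cnj_ell2)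

lemma ip_smult_right_ell2:
  assumes "x \<in> carrier ell2" "y \<in> carrier ell2"
  shows "ip ell2 y (\<lambda>n. c * x n) = cnj c * ip ell2 y x"
  using arg_cong[OF ip_smult_left_ell2[OF assms, of c], of cnj] assms by (simp add: ip_cnj_ell2)

lemma ip_diff_left_ell2:
  assumes "x \<in> carrier ell2" "y \<in> carrier ell2" "z \<in> carrier ell2"
  shows "ip ell2 (\<lambda>n. x n - y n) z = ip ell2 x z - ip ell2 y z"
  using ip_add_left_ell2[OF assms(1) ell2_smult[OF assms(2), of "-1"] assms(3)]
    ip_smult_left_ell2[OF assms(2,3), of "-1"] by simp

lemma ip_self_ell2:
  assumes "x \<in> carrier ell2"
  shows "ip ell2 x x = complex_of_real (\<Sum>n. (cmod (x n))\<^sup>2)"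
proof -
  have "(\<lambda>n. complex_of_real ((cmod (x n))\<^sup>2)) sums complex_of_real (\<Sum>n. (cmod (x n))\<^sup>2)"
    using assms by (intro sums_of_real summable_sums) (simp add: mem_ell2_iff)
  then have "(\<lambda>n. x n * cnj (x n)) sums complex_of_real (\<Sum>n. (cmod (x n))\<^sup>2)"
    unfolding complex_norm_square .
  then show ?thesis unfolding ip_ell2 by (rule sums_unique[symmetric])
qed

lemma hnorm_sq_ell2:
  assumes "x \<in> carrier ell2"
  shows "(hnorm ell2 x)\<^sup>2 = (\<Sum>n. (cmod (x n))\<^sup>2)"
  using assms by (simp add: hnorm_def ip_self_ell2 suminf_nonneg mem_ell2_iff)

lemma ip_self_hnorm:
  assumes "x \<in> carrier ell2"
  shows "ip ell2 x x = complex_of_real ((hnorm ell2 x)\<^sup>2)"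
  using ip_self_ell2 hnorm_sq_ell2 assms by simp

lemma hnorm_nonneg [simp]: "x \<in> carrier ell2 \<Longrightarrow> 0 \<le> hnorm ell2 x"
  by (simp add: hnorm_def ip_self_ell2 suminf_nonneg mem_ell2_iff)

lemma hnorm_le_iff:
  assumes "x \<in> carrier ell2" "0 \<le> C"
  shows "hnorm ell2 x \<le> C \<longleftrightarrow> (\<Sum>n. (cmod (x n))\<^sup>2) \<le> C\<^sup>2"
  using assms hnorm_sq_ell2[OF assms(1)]
  by (metis abs_le_square_iff abs_of_nonneg hnorm_nonneg)

lemma sum_cmod_sq_le_hnorm:
  assumes "x \<in> carrier ell2"
  shows "(\<Sum>n<N. (cmod (x n))\<^sup>2) \<le> (hnorm ell2 x)\<^sup>2"
  using assms unfolding hnorm_sq_ell2[OF assms] mem_ell2_iff by (intro sum_le_suminf) auto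

lemma cmod_le_hnorm:
  assumes "x \<in> carrier ell2"
  shows "cmod (x n) \<le> hnorm ell2 x"
proof (rule power2_le_imp_le)
  have "(cmod (x n))\<^sup>2 \<le> (\<Sum>k<Suc n. (cmod (x k))\<^sup>2)"
    by (simp add: sum_nonneg)
  then show "(cmod (x n))\<^sup>2 \<le> (hnorm ell2 x)\<^sup>2"
    using sum_cmod_sq_le_hnorm[OF assms, of "Suc n"] by linarith
qed (use assms in auto)

lemma ell2_bounded_sums:
  assumes "\<And>N. (\<Sum>n<N. (cmod (x n))\<^sup>2) \<le> C\<^sup>2" "0 \<le> C"
  shows "x \<in> carrier ell2" "hnorm ell2 x \<le> C"
proof -
  have s: "summable (\<lambda>n. (cmod (x n))\<^sup>2)"
    by (rule summableI_nonneg_bounded[of _ "C\<^sup>2"]) (use assms(1) in auto)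
  then show x: "x \<in> carrier ell2" by (simp add: mem_ell2_iff)
  show "hnorm ell2 x \<le> C"
    unfolding hnorm_le_iff[OF x assms(2)] using s assms(1) by (rule suminf_le_const)
qed

lemma cauchy_schwarz_ell2:
  assumes "x \<in> carrier ell2" "y \<in> carrier ell2"
  shows "cmod (ip ell2 x y) \<le> hnorm ell2 x * hnorm ell2 y"
proof -
  have L2: "L2_set (\<lambda>n. cmod (z n)) {..<N} \<le> hnorm ell2 z" if "z \<in> carrier ell2" for z N
    unfolding L2_set_def using that sum_cmod_sq_le_hnorm[OF that]
    by (simp add: real_le_lsqrt sum_nonneg)
  have "cmod (ip ell2 x y) \<le> (\<Sum>n. cmod (x n * cnj (y n)))"
    unfolding ip_ell2 by (rule summable_norm[OF summable_norm_ip[OF assms]])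
  also have "\<dots> \<le> hnorm ell2 x * hnorm ell2 y"
  proof (rule suminf_le_const[OF summable_norm_ip[OF assms]])
    fix N
    have "(\<Sum>n<N. cmod (x n * cnj (y n))) = (\<Sum>n<N. \<bar>cmod (x n)\<bar> * \<bar>cmod (y n)\<bar>)"
      by (simp add: norm_mult)
    also have "\<dots> \<le> L2_set (\<lambda>n. cmod (x n)) {..<N} * L2_set (\<lambda>n. cmod (y n)) {..<N}"
      by (rule L2_set_mult_ineq)
    also have "\<dots> \<le> hnorm ell2 x * hnorm ell2 y"
      using assms by (intro mult_mono L2) auto
    finally show "(\<Sum>n<N. cmod (x n * cnj (y n))) \<le> hnorm ell2 x * hnorm ell2 y" .
  qed
  finally show ?thesis .
qed

lemma abelian_group_ell2: "abelian_group ell2"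
proof (rule abelian_groupI)
  fix x assume x: "x \<in> carrier ell2"
  show "\<exists>y\<in>carrier ell2. y \<oplus>\<^bsub>ell2\<^esub> x = \<zero>\<^bsub>ell2\<^esub>"
    using ell2_smult[OF x, of "-1"] by (intro bexI[of _ "\<lambda>n. - x n"]) auto
qed (auto simp: add_ac)

lemma ell2_minus:
  assumes "x \<in> carrier ell2" "y \<in> carrier ell2"
  shows "x \<ominus>\<^bsub>ell2\<^esub> y = (\<lambda>n. x n - y n)"
proof -
  have "(\<lambda>n. - y n) \<in> carrier ell2" using ell2_smult[OF assms(2), of "-1"] by simp
  then have "\<ominus>\<^bsub>ell2\<^esub> y = (\<lambda>n. - y n)"
    using assms(2) by (intro abelian_group.minus_equality[OF abelian_group_ell2]) auto
  then show ?thesis by (simp add: a_minus_def)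
qed

lemma cauchy_complete_ell2:
  fixes u :: "nat \<Rightarrow> nat \<Rightarrow> complex"
  assumes u: "\<And>n. u n \<in> carrier ell2"
    and C: "\<And>e. e > 0 \<Longrightarrow> \<exists>M. \<forall>m\<ge>M. \<forall>n\<ge>M. hnorm ell2 (\<lambda>k. u m k - u n k) < e"
  shows "\<exists>x\<in>carrier ell2. (\<lambda>n. hnorm ell2 (\<lambda>k. u n k - x k)) \<longlonglongrightarrow> 0"
proof -
  have "convergent (\<lambda>n. u n k)" for k
  proof (rule Cauchy_convergent, rule metric_CauchyI)
    fix e :: real assume "e > 0"
    then obtain M where M: "\<And>m n. m \<ge> M \<Longrightarrow> n \<ge> M \<Longrightarrow> hnorm ell2 (\<lambda>k. u m k - u n k) < e"
      using C by blast
    have "dist (u m k) (u n k) < e" if "m \<ge> M" "n \<ge> M" for m n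
      using M[OF that] cmod_le_hnorm[OF ell2_diff[OF u[of m] u[of n]], of k]
      by (simp add: dist_norm)
    then show "\<exists>M. \<forall>m\<ge>M. \<forall>n\<ge>M. dist (u m k) (u n k) < e" by blast
  qed
  then obtain x where x: "\<And>k. (\<lambda>n. u n k) \<longlonglongrightarrow> x k"
    unfolding convergent_def by metis
  \<comment> \<open>Finite partial sums of the Cauchy bound survive the coordinatewise limit.\<close>
  have lim: "\<exists>M. \<forall>n\<ge>M. (\<lambda>k. u n k - x k) \<in> carrier ell2 \<and> hnorm ell2 (\<lambda>k. u n k - x k) \<le> e"
    if e: "e > 0" for e
  proof -
    obtain M where M: "\<And>m n. m \<ge> M \<Longrightarrow> n \<ge> M \<Longrightarrow> hnorm ell2 (\<lambda>k. u m k - u n k) < e"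
      using C[OF e] by blast
    have "(\<Sum>k<K. (cmod (u n k - x k))\<^sup>2) \<le> e\<^sup>2" if n: "n \<ge> M" for n K
    proof (rule LIMSEQ_le_const2)
      show "(\<lambda>m. \<Sum>k<K. (cmod (u n k - u m k))\<^sup>2) \<longlonglongrightarrow> (\<Sum>k<K. (cmod (u n k - x k))\<^sup>2)"
        by (intro tendsto_intros x)
      have "(\<Sum>k<K. (cmod (u n k - u m k))\<^sup>2) \<le> e\<^sup>2" if "m \<ge> M" for m
        using sum_cmod_sq_le_hnorm[OF ell2_diff[OF u[of n] u[of m]], of K]
          power_mono[OF less_imp_le[OF M[OF n that]], of 2] hnorm_nonneg[OF ell2_diff[OF u[of n] u[of m]]]
        by linarith
      then show "\<exists>N. \<forall>m\<ge>N. (\<Sum>k<K. (cmod (u n k - u m k))\<^sup>2) \<le> e\<^sup>2" by blast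
    qed
    then have "(\<lambda>k. u n k - x k) \<in> carrier ell2 \<and> hnorm ell2 (\<lambda>k. u n k - x k) \<le> e"
      if "n \<ge> M" for n
      using ell2_bounded_sums[OF _ less_imp_le[OF e], of "\<lambda>k. u n k - x k"] that by simp
    then show ?thesis by blast
  qed
  obtain M where "(\<lambda>k. u M k - x k) \<in> carrier ell2" using lim[of 1] by auto
  from ell2_diff[OF u[of M] this] have xc: "x \<in> carrier ell2" by simp
  have "(\<lambda>n. hnorm ell2 (\<lambda>k. u n k - x k)) \<longlonglongrightarrow> 0"
  proof (rule LIMSEQ_I)
    fix r :: real assume "r > 0"
    then obtain M where M: "\<And>n. n \<ge> M \<Longrightarrow> hnorm ell2 (\<lambda>k. u n k - x k) \<le> r/2"
      using lim[of "r/2"] by auto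
    have "norm (hnorm ell2 (\<lambda>k. u n k - x k) - 0) < r" if "n \<ge> M" for n
      using M[OF that] \<open>r > 0\<close> hnorm_nonneg[OF ell2_diff[OF u[of n] xc]] by simp
    then show "\<exists>no. \<forall>n\<ge>no. norm (hnorm ell2 (\<lambda>k. u n k - x k) - 0) < r" by blast
  qed
  with xc show ?thesis by blast
qed

lemma hilbert_space_ell2: "hilbert_space ell2"
proof (intro hilbert_space.intro hilbert_space_axioms.intro)
  show "module (ring_of_type_algebra :: complex ring) ell2"
    by (rule moduleI[OF cring_from_type_algebra abelian_group_ell2])
      (auto simp: ring_of_type_algebra_def algebra_simps)
next
  fix x assume "x \<in> carrier ell2"
  then show "ip ell2 x x \<in> \<real>\<^sub>\<ge>\<^sub>0"
    by (simp add: ip_self_hnorm del: of_real_power)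
next
  fix x assume x: "x \<in> carrier ell2" "ip ell2 x x = 0"
  then have "hnorm ell2 x = 0" by (simp add: hnorm_def)
  then show "x = \<zero>\<^bsub>ell2\<^esub>" using cmod_le_hnorm[OF x(1)] by (simp add: fun_eq_iff)
next
  fix u :: "nat \<Rightarrow> nat \<Rightarrow> complex"
  assume u: "\<And>n. u n \<in> carrier ell2"
    and "\<And>e. e > 0 \<Longrightarrow> \<exists>M. \<forall>m\<ge>M. \<forall>n\<ge>M. hnorm ell2 (u m \<ominus>\<^bsub>ell2\<^esub> u n) < e"
  then show "\<exists>x\<in>carrier ell2. (\<lambda>n. hnorm ell2 (u n \<ominus>\<^bsub>ell2\<^esub> x)) \<longlonglongrightarrow> 0"
    using cauchy_complete_ell2[of u] by (simp add: ell2_minus)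
qed (simp_all add: ip_add_left_ell2 ip_smult_left_ell2 ip_cnj_ell2)

section \<open>Bounded operators and adjoints\<close>

definition unit_vec :: "nat \<Rightarrow> nat \<Rightarrow> complex" where
  "unit_vec n = (\<lambda>k. if k = n then 1 else 0)"

lemma unit_vec_apply [simp]: "unit_vec n k = (if k = n then 1 else 0)"
  by (simp add: unit_vec_def)

lemma finite_support_ell2:
  assumes "finite F" "\<And>n. n \<notin> F \<Longrightarrow> x n = 0"
  shows "x \<in> carrier ell2"
  unfolding mem_ell2_iff by (rule summable_finite[OF assms(1)]) (use assms(2) in auto)

lemma unit_vec_ell2 [simp]: "unit_vec n \<in> carrier ell2"
  by (rule finite_support_ell2[of "{n}"]) auto

lemma ip_unit_vec_right [simp]: "ip ell2 x (unit_vec n) = x n"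
proof -
  have "ip ell2 x (unit_vec n) = (\<Sum>k\<in>{n}. x k * cnj (unit_vec n k))"
    unfolding ip_ell2 by (rule suminf_finite) auto
  then show ?thesis by simp
qed

lemma ip_unit_vec_left [simp]: "x \<in> carrier ell2 \<Longrightarrow> ip ell2 (unit_vec n) x = cnj (x n)"
  using ip_cnj_ell2[of x "unit_vec n"] by simp

lemma bounded_ops_ell2D:
  assumes "A \<in> bounded_ops ell2"
  shows "x \<in> carrier ell2 \<Longrightarrow> A x \<in> carrier ell2"
    and "x \<in> carrier ell2 \<Longrightarrow> y \<in> carrier ell2 \<Longrightarrow> A (\<lambda>n. x n + y n) = (\<lambda>n. A x n + A y n)"
    and "x \<in> carrier ell2 \<Longrightarrow> A (\<lambda>n. c * x n) = (\<lambda>n. c * A x n)"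
    and "A \<in> extensional (carrier ell2)"
  using assms by (auto simp: bounded_ops_def PiE_def)

lemma bounded_ops_ell2_diff:
  assumes "A \<in> bounded_ops ell2" "x \<in> carrier ell2" "y \<in> carrier ell2"
  shows "A (\<lambda>n. x n - y n) = (\<lambda>n. A x n - A y n)"
  using bounded_ops_ell2D(2)[OF assms(1,2) ell2_smult[OF assms(3), of "-1"]]
    bounded_ops_ell2D(3)[OF assms(1,3), of "-1"] by simp

lemma bounded_ops_ell2_zero:
  assumes "A \<in> bounded_ops ell2"
  shows "A (\<lambda>n. 0) = (\<lambda>n. 0)"
  using bounded_ops_ell2D(3)[OF assms ell2_zero, of 0] by simp

lemma bounded_ops_ell2_bound:
  assumes "A \<in> bounded_ops ell2"
  obtains C where "0 \<le> C" "\<And>x. x \<in> carrier ell2 \<Longrightarrow> hnorm ell2 (A x) \<le> C * hnorm ell2 x"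
proof -
  obtain C where C: "\<And>x. x \<in> carrier ell2 \<Longrightarrow> hnorm ell2 (A x) \<le> C * hnorm ell2 x"
    using assms unfolding bounded_ops_def by blast
  have "hnorm ell2 (A x) \<le> \<bar>C\<bar> * hnorm ell2 x" if "x \<in> carrier ell2" for x
    using C[OF that] mult_right_mono[OF abs_ge_self[of C] hnorm_nonneg[OF that]] by linarith
  then show ?thesis using that[of "\<bar>C\<bar>"] by simp
qed

lemma bounded_ops_ell2I:
  assumes "A \<in> extensional (carrier ell2)"
    and "\<And>x. x \<in> carrier ell2 \<Longrightarrow> A x \<in> carrier ell2"
    and "\<And>x y. x \<in> carrier ell2 \<Longrightarrow> y \<in> carrier ell2 \<Longrightarrow> A (\<lambda>n. x n + y n) = (\<lambda>n. A x n + A y n)"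
    and "\<And>c x. x \<in> carrier ell2 \<Longrightarrow> A (\<lambda>n. c * x n) = (\<lambda>n. c * A x n)"
    and "\<And>x. x \<in> carrier ell2 \<Longrightarrow> hnorm ell2 (A x) \<le> C * hnorm ell2 x"
  shows "A \<in> bounded_ops ell2"
  unfolding bounded_ops_def PiE_def
  using assms(1-4) by (auto intro!: exI[of _ C] assms(5))

lemma ops_eqI:
  assumes "A \<in> extensional (carrier ell2)" "B \<in> extensional (carrier ell2)"
    and "\<And>x n. x \<in> carrier ell2 \<Longrightarrow> A x n = B x n"
  shows "A = B"
  using assms by (intro extensionalityI[of A "carrier ell2" B]) auto

definition trunc :: "nat \<Rightarrow> (nat \<Rightarrow> complex) \<Rightarrow> nat \<Rightarrow> complex" where
  "trunc N x = (\<lambda>n. if n < N then x n else 0)"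

lemma trunc_ell2 [simp]: "trunc N x \<in> carrier ell2"
  by (rule finite_support_ell2[of "{..<N}"]) (auto simp: trunc_def)

lemma trunc_Suc: "trunc (Suc N) x = (\<lambda>n. trunc N x n + x N * unit_vec N n)"
  by (auto simp: trunc_def less_Suc_eq)

text \<open>
  Matrix elements determine a bounded operator: on finitely supported vectors by linearity, and in
  general by the approximation \<open>trunc_tendsto\<close>.
\<close>

lemma ip_op_trunc:
  assumes A: "A \<in> bounded_ops ell2" and y: "y \<in> carrier ell2"
  shows "ip ell2 (A (trunc N x)) y = (\<Sum>n<N. x n * ip ell2 (A (unit_vec n)) y)"
proof (induction N)
  case 0
  have "trunc 0 x = (\<lambda>n. 0)" by (simp add: trunc_def)
  then show ?case by (simp add: bounded_ops_ell2_zero[OF A] ip_ell2)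
next
  case (Suc N)
  have "A (trunc (Suc N) x) = (\<lambda>n. A (trunc N x) n + x N * A (unit_vec N) n)"
    by (simp only: trunc_Suc bounded_ops_ell2D(2,3)[OF A] trunc_ell2 unit_vec_ell2 ell2_smult)
  then show ?case using Suc
    by (simp del: unit_vec_apply add: ip_add_left_ell2 ip_smult_left_ell2 bounded_ops_ell2D(1)[OF A] y)
qed

lemma trunc_tendsto:
  assumes x: "x \<in> carrier ell2"
  shows "(\<lambda>N. hnorm ell2 (\<lambda>n. x n - trunc N x n)) \<longlonglongrightarrow> 0"
proof -
  let ?g = "\<lambda>n. (cmod (x n))\<^sup>2"
  have g: "?g sums (hnorm ell2 x)\<^sup>2"
    using x unfolding hnorm_sq_ell2[OF x] mem_ell2_iff by (rule summable_sums)
  have eq: "(hnorm ell2 (\<lambda>n. x n - trunc N x n))\<^sup>2 = (hnorm ell2 x)\<^sup>2 - (\<Sum>n<N. ?g n)" for N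
  proof -
    have "(\<lambda>n. ?g n - (if n \<in> {..<N} then ?g n else 0)) sums ((hnorm ell2 x)\<^sup>2 - (\<Sum>n<N. ?g n))"
      by (intro sums_diff g sums_If_finite_set) simp
    moreover have "?g n - (if n \<in> {..<N} then ?g n else 0) = (cmod (x n - trunc N x n))\<^sup>2" for n
      by (simp add: trunc_def)
    ultimately have "(\<lambda>n. (cmod (x n - trunc N x n))\<^sup>2) sums ((hnorm ell2 x)\<^sup>2 - (\<Sum>n<N. ?g n))"
      by simp
    then show ?thesis using hnorm_sq_ell2[OF ell2_diff[OF x trunc_ell2]] by (simp add: sums_iff)
  qed
  have "(\<lambda>N. sqrt ((hnorm ell2 x)\<^sup>2 - (\<Sum>n<N. ?g n))) \<longlonglongrightarrow> sqrt ((hnorm ell2 x)\<^sup>2 - (hnorm ell2 x)\<^sup>2)"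
    using g unfolding sums_def by (intro tendsto_intros)
  then show ?thesis
    unfolding eq[symmetric] using hnorm_nonneg[OF ell2_diff[OF x trunc_ell2]] by simp
qed

text \<open>
  The matrix forces \<open>(B y) n = \<langle>y, A e\<^sub>n\<rangle>\<close>.  That this sequence is square-summable with norm at most
  \<open>C \<parallel>y\<parallel>\<close> follows by testing \<open>A\<close> on the truncations \<open>z\<close> of \<open>B y\<close> itself:
  \<open>\<parallel>z\<parallel>\<^sup>2 = \<langle>A z, y\<rangle> \<le> C \<parallel>z\<parallel> \<parallel>y\<parallel>\<close>.  Existence matters because \<^const>\<open>adj\<close> is a definite description:
  only once an adjoint exists does \<open>adj ell2 P = P\<close> say that \<open>P\<close> is self-adjoint.
\<close>

lemma adjoint_exists:
  assumes A: "A \<in> bounded_ops ell2"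
  shows "\<exists>B\<in>bounded_ops ell2. \<forall>x\<in>carrier ell2. \<forall>y\<in>carrier ell2. ip ell2 (A x) y = ip ell2 x (B y)"
proof -
  obtain C where C0: "0 \<le> C" and C: "\<And>x. x \<in> carrier ell2 \<Longrightarrow> hnorm ell2 (A x) \<le> C * hnorm ell2 x"
    using bounded_ops_ell2_bound[OF A] by blast
  note Ac = bounded_ops_ell2D(1)[OF A]
  define B where "B = (\<lambda>y\<in>carrier ell2. \<lambda>n. ip ell2 y (A (unit_vec n)))"
  have Bapp: "B y n = ip ell2 y (A (unit_vec n))" if "y \<in> carrier ell2" for y n
    using that by (simp add: B_def)
  have ip_trunc: "ip ell2 (A (trunc N x)) y = (\<Sum>n<N. x n * cnj (B y n))"
    if y: "y \<in> carrier ell2" for x y N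
    unfolding ip_op_trunc[OF A y] by (simp add: Bapp[OF y] ip_cnj_ell2 y Ac)
  have bnd: "(\<Sum>n<N. (cmod (B y n))\<^sup>2) \<le> (C * hnorm ell2 y)\<^sup>2" if y: "y \<in> carrier ell2" for y N
  proof -
    define z where "z = trunc N (B y)"
    have z: "z \<in> carrier ell2" by (simp add: z_def)
    have "(\<Sum>n. (cmod (z n))\<^sup>2) = (\<Sum>n<N. (cmod (z n))\<^sup>2)"
      by (rule suminf_finite) (auto simp: z_def trunc_def)
    then have S: "(hnorm ell2 z)\<^sup>2 = (\<Sum>n<N. (cmod (B y n))\<^sup>2)"
      by (simp add: hnorm_sq_ell2[OF z]) (simp add: z_def trunc_def)
    have "ip ell2 (A z) y = complex_of_real (\<Sum>n<N. (cmod (B y n))\<^sup>2)"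
      unfolding z_def ip_trunc[OF y] of_real_sum complex_norm_square ..
    then have "(hnorm ell2 z)\<^sup>2 = cmod (ip ell2 (A z) y)"
      unfolding S by (simp add: sum_nonneg del: of_real_sum of_real_power)
    also have "\<dots> \<le> hnorm ell2 (A z) * hnorm ell2 y"
      by (rule cauchy_schwarz_ell2[OF Ac[OF z] y])
    also have "\<dots> \<le> (C * hnorm ell2 z) * hnorm ell2 y"
      by (rule mult_right_mono[OF C[OF z] hnorm_nonneg[OF y]])
    finally have le: "hnorm ell2 z * hnorm ell2 z \<le> hnorm ell2 z * (C * hnorm ell2 y)"
      by (simp add: power2_eq_square mult_ac)
    have "hnorm ell2 z \<le> C * hnorm ell2 y"
    proof (cases "hnorm ell2 z = 0")
      case False
      then show ?thesis using le hnorm_nonneg[OF z] by (simp add: mult_le_cancel_left)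
    qed (use C0 y in simp)
    then have "(hnorm ell2 z)\<^sup>2 \<le> (C * hnorm ell2 y)\<^sup>2"
      by (rule power_mono[OF _ hnorm_nonneg[OF z]])
    then show ?thesis by (simp add: S)
  qed
  have Cy: "0 \<le> C * hnorm ell2 y" if "y \<in> carrier ell2" for y using C0 that by simp
  have Bc: "B y \<in> carrier ell2" "hnorm ell2 (B y) \<le> C * hnorm ell2 y" if "y \<in> carrier ell2" for y
    using ell2_bounded_sums[OF bnd[OF that] Cy[OF that]] by auto
  have "B \<in> bounded_ops ell2"
  proof (rule bounded_ops_ell2I[where C = C])
    show "B \<in> extensional (carrier ell2)" by (simp add: B_def)
  qed (auto simp: Bc Bapp ip_add_left_ell2 ip_smult_left_ell2 Ac intro: Bc(2))
  moreover have "ip ell2 (A x) y = ip ell2 x (B y)"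
    if x: "x \<in> carrier ell2" and y: "y \<in> carrier ell2" for x y
  proof -
    have "(\<lambda>N. ip ell2 (A (trunc N x)) y) \<longlonglongrightarrow> ip ell2 x (B y)"
      unfolding ip_trunc[OF y] ip_ell2[of x]
      using summable_sums[OF summable_ip[OF x Bc(1)[OF y]]] by (simp add: sums_def)
    moreover have "(\<lambda>N. ip ell2 (A (trunc N x)) y) \<longlonglongrightarrow> ip ell2 (A x) y"
    proof (rule LIM_zero_cancel, rule Lim_null_comparison)
      let ?d = "\<lambda>N. hnorm ell2 (\<lambda>n. x n - trunc N x n)"
      show "\<forall>\<^sub>F N in sequentially. norm (ip ell2 (A (trunc N x)) y - ip ell2 (A x) y) \<le> C * ?d N * hnorm ell2 y"
      proof (intro always_eventually allI)
        fix N
        have d: "(\<lambda>n. x n - trunc N x n) \<in> carrier ell2" using x by simp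
        have "ip ell2 (A (trunc N x)) y - ip ell2 (A x) y = - ip ell2 (A (\<lambda>n. x n - trunc N x n)) y"
          by (simp add: bounded_ops_ell2_diff[OF A x] ip_diff_left_ell2 Ac x y)
        then have "norm (ip ell2 (A (trunc N x)) y - ip ell2 (A x) y)
            \<le> hnorm ell2 (A (\<lambda>n. x n - trunc N x n)) * hnorm ell2 y"
          using cauchy_schwarz_ell2[OF Ac[OF d] y] by simp
        also have "\<dots> \<le> C * ?d N * hnorm ell2 y"
          by (rule mult_right_mono[OF C[OF d] hnorm_nonneg[OF y]])
        finally show "norm (ip ell2 (A (trunc N x)) y - ip ell2 (A x) y) \<le> C * ?d N * hnorm ell2 y" .
      qed
      show "(\<lambda>N. C * ?d N * hnorm ell2 y) \<longlonglongrightarrow> 0"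
        using tendsto_mult[OF tendsto_mult[OF tendsto_const[of C] trunc_tendsto[OF x]]
            tendsto_const[of "hnorm ell2 y"]] by simp
    qed
    ultimately show ?thesis using LIMSEQ_unique by blast
  qed
  ultimately show ?thesis by blast
qed

lemma adj_eqI:
  assumes A: "A \<in> bounded_ops ell2" and B: "B \<in> bounded_ops ell2"
    and AB: "\<And>x y. x \<in> carrier ell2 \<Longrightarrow> y \<in> carrier ell2 \<Longrightarrow> ip ell2 (A x) y = ip ell2 x (B y)"
  shows "adj ell2 A = B"
  unfolding adj_def
proof (rule the_equality)
  fix B' assume B': "B' \<in> bounded_ops ell2 \<and>
    (\<forall>x\<in>carrier ell2. \<forall>y\<in>carrier ell2. ip ell2 (A x) y = ip ell2 x (B' y))"
  show "B' = B"
  proof (rule ops_eqI)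
    fix y n assume y: "y \<in> carrier ell2"
    have "ip ell2 (unit_vec n) (B' y) = ip ell2 (unit_vec n) (B y)"
      using B' AB[OF unit_vec_ell2 y] y unit_vec_ell2 by metis
    then show "B' y n = B y n"
      using B' B y by (simp add: bounded_ops_ell2D(1))
  qed (use B B' bounded_ops_ell2D(4) in blast)+
qed (use B AB in blast)

lemma ip_adj:
  assumes "A \<in> bounded_ops ell2" "x \<in> carrier ell2" "y \<in> carrier ell2"
  shows "ip ell2 (A x) y = ip ell2 x (adj ell2 A y)"
  using adjoint_exists[OF assms(1)] adj_eqI[OF assms(1)] assms(2,3) by metis

text \<open>
  Complex polarization: if \<open>q\<close> is the difference of the two sesquilinear forms, then
  \<open>q u v + q v u = 0\<close>, and replacing \<open>u\<close> by \<open>\<i> u\<close> gives \<open>q u v - q v u = 0\<close>.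
\<close>

lemma op_eq_of_quadratic_form:
  assumes A: "A \<in> bounded_ops ell2" and B: "B \<in> bounded_ops ell2"
    and eq: "\<And>x. x \<in> carrier ell2 \<Longrightarrow> ip ell2 (A x) x = ip ell2 (B x) x"
  shows "A = B"
proof (rule ops_eqI)
  fix x n assume x: "x \<in> carrier ell2"
  define q where "q u v = ip ell2 (A u) v - ip ell2 (B u) v" for u v
  have q0: "q u u = 0" if "u \<in> carrier ell2" for u
    using eq[OF that] by (simp add: q_def)
  have qa: "q u v + q v u = 0" if u: "u \<in> carrier ell2" and v: "v \<in> carrier ell2" for u v
    using q0[OF ell2_add[OF u v]] q0[OF u] q0[OF v] u v
    by (simp add: q_def bounded_ops_ell2D[OF A] bounded_ops_ell2D[OF B]
        ip_add_left_ell2 ip_add_right_ell2 algebra_simps)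
  define e where "e = unit_vec n"
  have e: "e \<in> carrier ell2" by (simp add: e_def)
  have "q (\<lambda>k. \<i> * x k) e = \<i> * q x e" "q e (\<lambda>k. \<i> * x k) = - \<i> * q e x"
    using x e by (simp_all add: q_def bounded_ops_ell2D[OF A] bounded_ops_ell2D[OF B]
        ip_smult_left_ell2 ip_smult_right_ell2 algebra_simps)
  then have "\<i> * (q x e - q e x) = 0"
    using qa[OF ell2_smult[OF x, of \<i>] e] by (simp add: algebra_simps)
  then have "q x e = q e x" by simp
  then have "q x e = 0" using qa[OF x e] by simp
  then show "A x n = B x n" by (simp add: q_def e_def)
qed (use A B bounded_ops_ell2D(4) in blast)+

section \<open>Diagonal operators\<close>

definition diag :: "(nat \<Rightarrow> complex) \<Rightarrow> (nat \<Rightarrow> complex) \<Rightarrow> nat \<Rightarrow> complex" where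
  "diag f = (\<lambda>x\<in>carrier ell2. \<lambda>n. f n * x n)"

lemma diag_apply [simp]: "x \<in> carrier ell2 \<Longrightarrow> diag f x = (\<lambda>n. f n * x n)"
  by (simp add: diag_def)

lemma diag_extensional [simp]: "diag f \<in> extensional (carrier ell2)"
  by (simp add: diag_def)

lemma diag_closed:
  assumes f: "bounded (range f)" and x: "x \<in> carrier ell2"
  shows "(\<lambda>n. f n * x n) \<in> carrier ell2"
proof -
  obtain C where C: "\<And>n. cmod (f n) \<le> C" using f by (auto simp: bounded_iff)
  show ?thesis
  proof (rule ell2_dominated)
    show "summable (\<lambda>n. C\<^sup>2 * (cmod (x n))\<^sup>2)" using x by (simp add: mem_ell2_iff summable_mult)
    show "(cmod (f n * x n))\<^sup>2 \<le> C\<^sup>2 * (cmod (x n))\<^sup>2" for n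
      unfolding norm_mult power_mult_distrib by (intro mult_right_mono power_mono C) auto
  qed
qed

lemma diag_bounded_op:
  assumes f: "bounded (range f)"
  shows "diag f \<in> bounded_ops ell2"
proof -
  obtain C where C: "\<And>n. cmod (f n) \<le> C" using f by (auto simp: bounded_iff)
  have C0: "0 \<le> C" using C[of 0] norm_ge_zero[of "f 0"] by linarith
  show ?thesis
  proof (rule bounded_ops_ell2I[where C = C])
    fix x assume x: "x \<in> carrier ell2"
    have "(\<Sum>n<N. (cmod (f n * x n))\<^sup>2) \<le> (C * hnorm ell2 x)\<^sup>2" for N
    proof -
      have "(\<Sum>n<N. (cmod (f n * x n))\<^sup>2) \<le> (\<Sum>n<N. C\<^sup>2 * (cmod (x n))\<^sup>2)"
        unfolding norm_mult power_mult_distrib by (intro sum_mono mult_right_mono power_mono C) auto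
      also have "\<dots> \<le> C\<^sup>2 * (hnorm ell2 x)\<^sup>2"
        unfolding sum_distrib_left[symmetric] by (intro mult_left_mono sum_cmod_sq_le_hnorm x) simp
      finally show ?thesis by (simp add: power_mult_distrib)
    qed
    then show "hnorm ell2 (diag f x) \<le> C * hnorm ell2 x"
      using ell2_bounded_sums(2)[of "\<lambda>n. f n * x n" "C * hnorm ell2 x"] x C0 by simp
  qed (auto simp: diag_closed[OF f] distrib_left mult.left_commute)
qed

lemma diag_unit_vec [simp]: "diag f (unit_vec n) = (\<lambda>k. f n * unit_vec n k)"
  by (auto simp: fun_eq_iff)

lemma diag_inject [simp]: "diag f = diag g \<longleftrightarrow> f = g"
proof
  assume "diag f = diag g"
  then have "diag f (unit_vec n) n = diag g (unit_vec n) n" for n by simp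
  then show "f = g" by (auto simp: fun_eq_iff)
qed simp

lemma op_mult_diag:
  assumes "bounded (range g)"
  shows "op_mult ell2 (diag f) (diag g) = diag (\<lambda>n. f n * g n)"
  by (rule ops_eqI) (auto simp: compose_def diag_closed[OF assms] mult.assoc)

lemma op_add_diag: "op_add ell2 (diag f) (diag g) = diag (\<lambda>n. f n + g n)"
  by (rule ops_eqI) (auto simp: op_add_def distrib_right)

lemma op_scale_diag: "op_scale ell2 c (diag f) = diag (\<lambda>n. c * f n)"
  by (rule ops_eqI) (auto simp: op_scale_def mult_ac)

lemma op_id_diag: "op_id ell2 = diag (\<lambda>n. 1)"
  by (rule ops_eqI) (auto simp: op_id_def)

lemma op_zero_diag: "op_zero ell2 = diag (\<lambda>n. 0)"
  by (rule ops_eqI) (auto simp: op_zero_def)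

lemma bounded_range_cnj: "bounded (range f) \<Longrightarrow> bounded (range (\<lambda>n. cnj (f n)))"
  by (simp add: bounded_iff)

lemma adj_diag:
  assumes f: "bounded (range f)"
  shows "adj ell2 (diag f) = diag (\<lambda>n. cnj (f n))"
  by (rule adj_eqI)
    (auto simp: diag_bounded_op f bounded_range_cnj ip_ell2 mult_ac)

lemma of_real_fun_eq_iff [simp]:
  "(\<lambda>n. complex_of_real (f n)) = (\<lambda>n. complex_of_real (g n)) \<longleftrightarrow> f = g"
  by (auto simp: fun_eq_iff)

abbreviation rdiag :: "(nat \<Rightarrow> real) \<Rightarrow> (nat \<Rightarrow> complex) \<Rightarrow> nat \<Rightarrow> complex" where
  "rdiag f \<equiv> diag (\<lambda>n. complex_of_real (f n))"

lemma bounded_range_of_real: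
  "bounded (range (\<lambda>n. complex_of_real (f n))) \<longleftrightarrow> bounded (range f)"
  by (simp add: bounded_iff)

lemma ip_rdiag:
  assumes f: "bounded (range f)" and x: "x \<in> carrier ell2"
  shows "(\<lambda>n. f n * (cmod (x n))\<^sup>2) sums Re (ip ell2 (rdiag f x) x)"
    and "ip ell2 (rdiag f x) x = complex_of_real (\<Sum>n. f n * (cmod (x n))\<^sup>2)"
proof -
  have fx: "(\<lambda>n. complex_of_real (f n) * x n) \<in> carrier ell2"
    using diag_closed[OF _ x] f by (simp add: bounded_range_of_real)
  have "(\<lambda>n. complex_of_real (f n) * x n * cnj (x n)) sums ip ell2 (rdiag f x) x"
    using summable_sums[OF summable_ip[OF fx x]] by (simp add: ip_ell2 x)
  then have s: "(\<lambda>n. complex_of_real (f n * (cmod (x n))\<^sup>2)) sums ip ell2 (rdiag f x) x"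
    by (simp only: of_real_mult complex_norm_square mult.assoc)
  from sums_Re[OF s] show r: "(\<lambda>n. f n * (cmod (x n))\<^sup>2) sums Re (ip ell2 (rdiag f x) x)"
    by (simp del: of_real_mult of_real_power)
  from sums_of_real[OF r] s show "ip ell2 (rdiag f x) x = complex_of_real (\<Sum>n. f n * (cmod (x n))\<^sup>2)"
    using sums_unique2 sums_unique[OF r] by metis
qed

lemma diag_positive_iff:
  assumes "bounded (range f)"
  shows "diag f \<in> positive_ops ell2 \<longleftrightarrow> (\<forall>n. f n \<in> \<real>\<^sub>\<ge>\<^sub>0)"
proof
  assume pos: "diag f \<in> positive_ops ell2"
  have "ip ell2 (diag f (unit_vec n)) (unit_vec n) \<in> \<real>\<^sub>\<ge>\<^sub>0" for n
    using pos unit_vec_ell2 unfolding positive_ops_def by blast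
  then show "\<forall>n. f n \<in> \<real>\<^sub>\<ge>\<^sub>0" by simp
next
  assume nn: "\<forall>n. f n \<in> \<real>\<^sub>\<ge>\<^sub>0"
  then have eq: "f = (\<lambda>n. complex_of_real (Re (f n)))" and Re: "\<And>n. 0 \<le> Re (f n)"
    by (auto simp: complex_nonneg_Reals_iff complex_eq_iff)
  have b: "bounded (range (\<lambda>n. Re (f n)))"
    using assms eq bounded_range_of_real by metis
  have "ip ell2 (diag f x) x \<in> \<real>\<^sub>\<ge>\<^sub>0" if x: "x \<in> carrier ell2" for x
    using ip_rdiag[OF b x] Re unfolding eq[symmetric]
    by (simp add: suminf_nonneg sums_iff)
  then show "diag f \<in> positive_ops ell2"
    by (simp add: positive_ops_def diag_bounded_op assms)
qed

lemma rdiag_le_iff: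
  assumes "bounded (range f)" "bounded (range g)"
  shows "op_le ell2 (rdiag f) (rdiag g) \<longleftrightarrow> (\<forall>n. f n \<le> g n)"
proof -
  have b: "bounded (range (\<lambda>n. complex_of_real (g n) + (- complex_of_real (f n))))"
    using bounded_minus_comp[of "\<lambda>n. complex_of_real (g n)" UNIV "\<lambda>n. complex_of_real (f n)"] assms
    by (simp add: bounded_range_of_real)
  show ?thesis
    unfolding op_le_def op_scale_diag op_add_diag
    using diag_positive_iff[OF b] by (simp add: complex_nonneg_Reals_iff)
qed

section \<open>The algebra of diagonal operators\<close>

definition diag_algebra :: "((nat \<Rightarrow> complex) \<Rightarrow> nat \<Rightarrow> complex) set" where
  "diag_algebra = {diag f | f. bounded (range f)}"

lemma pos_part_diag_algebra:
  "pos_part ell2 diag_algebra = {rdiag f | f. bounded (range f) \<and> (\<forall>n. 0 \<le> f n)}"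
proof (intro equalityI subsetI)
  fix A assume "A \<in> pos_part ell2 diag_algebra"
  then obtain f where f: "bounded (range f)" "A = diag f" "\<forall>n. f n \<in> \<real>\<^sub>\<ge>\<^sub>0"
    by (auto simp: pos_part_def diag_algebra_def diag_positive_iff)
  then have eq: "f = (\<lambda>n. complex_of_real (Re (f n)))" and Re: "\<And>n. 0 \<le> Re (f n)"
    by (auto simp: complex_nonneg_Reals_iff complex_eq_iff)
  then show "A \<in> {rdiag f | f. bounded (range f) \<and> (\<forall>n. 0 \<le> f n)}"
    using f(1,2) bounded_range_of_real[of "\<lambda>n. Re (f n)", folded eq]
    by (intro CollectI exI[of _ "\<lambda>n. Re (f n)"]) (simp add: eq[symmetric])
next
  fix A assume "A \<in> {rdiag f | f. bounded (range f) \<and> (\<forall>n. 0 \<le> f n)}"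
  then obtain f where f: "A = rdiag f" "bounded (range f)" "\<forall>n. 0 \<le> f n" by blast
  then have b: "bounded (range (\<lambda>n. complex_of_real (f n)))" by (simp add: bounded_range_of_real)
  then show "A \<in> pos_part ell2 diag_algebra"
    using f diag_positive_iff[OF b] by (auto simp: pos_part_def diag_algebra_def)
qed

text \<open>
  An operator \<open>B\<close> commuting with the projection onto \<open>e\<^sub>n\<close> satisfies
  \<open>(B x) n = (B (x n \<cdot> e\<^sub>n)) n = x n \<cdot> (B e\<^sub>n) n\<close>, hence is diagonal.
\<close>

lemma commutant_diag_algebra: "commutant ell2 diag_algebra = diag_algebra"
proof (intro equalityI subsetI)
  fix A assume "A \<in> diag_algebra"
  then show "A \<in> commutant ell2 diag_algebra"
    by (auto simp: diag_algebra_def commutant_def diag_bounded_op op_mult_diag mult.commute)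
next
  fix B assume "B \<in> commutant ell2 diag_algebra"
  then have B: "B \<in> bounded_ops ell2"
    and com: "\<And>f. bounded (range f) \<Longrightarrow> op_mult ell2 (diag f) B = op_mult ell2 B (diag f)"
    by (auto simp: commutant_def diag_algebra_def)
  note Bc = bounded_ops_ell2D(1)[OF B]
  define f where "f n = B (unit_vec n) n" for n
  obtain C where C: "0 \<le> C" "\<And>x. x \<in> carrier ell2 \<Longrightarrow> hnorm ell2 (B x) \<le> C * hnorm ell2 x"
    using bounded_ops_ell2_bound[OF B] by blast
  have n1: "hnorm ell2 (unit_vec n) = 1" for n by (simp add: hnorm_def)
  have "cmod (f n) \<le> C" for n
    using cmod_le_hnorm[OF Bc[OF unit_vec_ell2], of n n] C(2)[OF unit_vec_ell2, of n]
    by (simp add: f_def n1)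
  then have f: "bounded (range f)" by (auto simp: bounded_iff)
  have "B = diag f"
  proof (rule ops_eqI)
    fix x n assume x: "x \<in> carrier ell2"
    have b: "bounded (range (unit_vec n))" by (rule boundedI[of _ 1]) auto
    have eq: "(\<lambda>k. unit_vec n k * x k) = (\<lambda>k. x n * unit_vec n k)" by auto
    have "op_mult ell2 (diag (unit_vec n)) B x n = op_mult ell2 B (diag (unit_vec n)) x n"
      using com[OF b] by simp
    then have "B x n = B (\<lambda>k. unit_vec n k * x k) n"
      using x Bc by (simp add: compose_def)
    also have "\<dots> = x n * f n"
      unfolding eq bounded_ops_ell2D(3)[OF B unit_vec_ell2] by (simp add: f_def)
    finally show "B x n = diag f x n" using x by (simp add: mult.commute)
  qed (use B bounded_ops_ell2D(4) diag_extensional in blast)+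
  then show "B \<in> diag_algebra" using f by (auto simp: diag_algebra_def)
qed

lemma von_neumann_diag_algebra: "von_neumann_algebra ell2 diag_algebra"
  unfolding von_neumann_algebra_def commutant_diag_algebra
  by (auto simp: diag_algebra_def diag_bounded_op adj_diag bounded_range_cnj)

section \<open>Weighted traces\<close>

definition diag_trace :: "(nat \<Rightarrow> real) \<Rightarrow> ((nat \<Rightarrow> complex) \<Rightarrow> nat \<Rightarrow> complex) \<Rightarrow> ennreal" where
  "diag_trace w A = (\<Sum>n. ennreal (w n) * ennreal (Re (A (unit_vec n) n)))"

lemma diag_trace_diag [simp]:
  "diag_trace w (diag f) = (\<Sum>n. ennreal (w n) * ennreal (Re (f n)))"
  by (simp add: diag_trace_def)

context
  fixes w :: "nat \<Rightarrow> real"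
  assumes w: "\<And>n. 0 < w n"
begin

lemma trace_on_diag_trace: "trace_on ell2 diag_algebra (diag_trace w)"
  unfolding trace_on_def
proof (intro conjI ballI allI impI)
  fix A B assume "A \<in> pos_part ell2 diag_algebra" "B \<in> pos_part ell2 diag_algebra"
  then obtain f g where "A = rdiag f" "B = rdiag g" "\<forall>n. 0 \<le> f n" "\<forall>n. 0 \<le> g n"
    by (auto simp: pos_part_diag_algebra)
  then show "diag_trace w (op_add ell2 A B) = diag_trace w A + diag_trace w B"
    by (simp add: op_add_diag diag_trace_def ennreal_plus distrib_left suminf_add[symmetric])
next
  fix c :: real and A assume c: "0 \<le> c" and "A \<in> pos_part ell2 diag_algebra"
  then obtain f where f: "A = rdiag f" "\<forall>n. 0 \<le> f n" by (auto simp: pos_part_diag_algebra)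
  then have "op_scale ell2 (complex_of_real c) A = rdiag (\<lambda>n. c * f n)"
    by (simp add: op_scale_diag)
  then show "diag_trace w (op_scale ell2 (complex_of_real c) A) = ennreal c * diag_trace w A"
    using f c by (simp add: ennreal_mult mult.left_commute[of _ "ennreal c"])
next
  fix A assume "A \<in> diag_algebra"
  then show "diag_trace w (op_mult ell2 (adj ell2 A) A) = diag_trace w (op_mult ell2 A (adj ell2 A))"
    by (auto simp: diag_algebra_def adj_diag op_mult_diag bounded_range_cnj mult.commute)
qed

lemma faithful_diag_trace: "faithful_trace ell2 diag_algebra (diag_trace w)"
  unfolding faithful_trace_def
proof (intro ballI impI)
  fix A assume "A \<in> pos_part ell2 diag_algebra" and 0: "diag_trace w A = 0"
  then obtain f where f: "A = rdiag f" "\<forall>n. 0 \<le> f n" by (auto simp: pos_part_diag_algebra)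
  have "ennreal (w n) * ennreal (f n) = 0" for n
    using 0 by (simp add: f(1) suminf_eq_zero_iff[OF summableI])
  then have "f n = 0" for n using w[of n] f(2) by (metis ennreal_eq_0_iff mult_eq_0_iff not_le order.antisym)
  then show "A = op_zero ell2" by (simp add: f(1) op_zero_diag)
qed

lemma semifinite_diag_trace: "semifinite_trace ell2 diag_algebra (diag_trace w)"
  unfolding semifinite_trace_def
proof (intro ballI impI)
  fix A assume "A \<in> pos_part ell2 diag_algebra" and nz: "A \<noteq> op_zero ell2"
  then obtain f where f: "A = rdiag f" "\<forall>n. 0 \<le> f n" "bounded (range f)"
    by (auto simp: pos_part_diag_algebra)
  have "\<exists>m. f m \<noteq> 0"
  proof (rule ccontr)
    assume "\<nexists>m. f m \<noteq> 0"
    then show False using nz by (simp add: f(1) op_zero_diag)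
  qed
  then obtain m where m: "f m \<noteq> 0" by blast
  define g where "g n = (if n = m then f m else 0)" for n
  have g: "bounded (range g)" by (rule boundedI[of _ "f m"]) (use f(2) in \<open>auto simp: g_def\<close>)
  have "rdiag g \<in> pos_part ell2 diag_algebra"
    using g f(2) unfolding pos_part_diag_algebra by (auto simp: g_def)
  moreover have "rdiag g \<noteq> op_zero ell2" using m by (auto simp: op_zero_diag g_def dest: fun_cong[of _ _ m])
  moreover have "op_le ell2 (rdiag g) A" using f by (simp add: rdiag_le_iff g) (simp add: g_def)
  moreover have "diag_trace w (rdiag g) = (\<Sum>n\<in>{m}. ennreal (w n) * ennreal (g n))"
    unfolding diag_trace_diag Re_complex_of_real by (rule suminf_finite) (auto simp: g_def)
  then have "diag_trace w (rdiag g) < \<infinity>" by (simp add: ennreal_mult_less_top)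
  ultimately show "\<exists>B\<in>pos_part ell2 diag_algebra. B \<noteq> op_zero ell2 \<and> op_le ell2 B A \<and> diag_trace w B < \<infinity>"
    by blast
qed

text \<open>
  The supremum of a bounded directed family in the algebra is its pointwise supremum \<open>g\<close>, because
  \<open>g\<close> is itself the diagonal of an upper bound in the algebra.  What remains is monotone convergence
  for the directed family of sums.
\<close>

lemma normal_diag_trace: "normal_trace ell2 diag_algebra (diag_trace w)"
  unfolding normal_trace_def
proof (intro allI impI, elim conjE)
  fix S A
  assume S: "S \<subseteq> pos_part ell2 diag_algebra" and dir: "op_directed ell2 S"
    and sup: "is_sup_in ell2 diag_algebra S A"
  define I where "I = {f. rdiag f \<in> S}"
  have I: "bounded (range f)" "0 \<le> f n" if "f \<in> I" for f n
    using that S by (auto simp: I_def pos_part_diag_algebra dest!: subsetD)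
  have SI: "S = rdiag ` I" using S by (auto simp: I_def pos_part_diag_algebra)
  then have I0: "I \<noteq> {}" using dir by (auto simp: op_directed_def)
  obtain a where a: "A = rdiag a" "bounded (range a)" "\<And>n. 0 \<le> a n"
    using sup by (auto simp: is_sup_in_def pos_part_diag_algebra)
  have ub: "f n \<le> a n" if "f \<in> I" for f n
    using sup that I a by (auto simp: is_sup_in_def SI rdiag_le_iff)
  have bdd: "bdd_above ((\<lambda>f. f n) ` I)" for n using ub by (auto simp: bdd_above_def)
  define g where "g n = (SUP f\<in>I. f n)" for n
  have fg: "f n \<le> g n" if "f \<in> I" for f n
    unfolding g_def by (rule cSUP_upper[OF that bdd])
  have ga: "g n \<le> a n" for n unfolding g_def by (rule cSUP_least[OF I0 ub])
  have g0: "0 \<le> g n" for n using fg I I0 by (meson all_not_in_conv order_trans)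
  have gb: "bounded (range g)"
  proof -
    obtain C where "\<And>n. \<bar>a n\<bar> \<le> C" using a(2) by (auto simp: bounded_iff)
    then have "\<bar>g n\<bar> \<le> C" for n using ga[of n] g0[of n] a(3)[of n] by (smt (verit))
    then show ?thesis by (auto simp: bounded_iff)
  qed
  have "rdiag g \<in> pos_part ell2 diag_algebra" using gb g0 by (auto simp: pos_part_diag_algebra)
  moreover have "\<forall>D\<in>S. op_le ell2 D (rdiag g)" using I gb fg by (auto simp: SI rdiag_le_iff)
  ultimately have "op_le ell2 A (rdiag g)" using sup by (auto simp: is_sup_in_def)
  then have ag: "a n = g n" for n using ga[of n] by (auto simp: a(1) rdiag_le_iff a(2) gb intro: order.antisym)
  have "(SUP f\<in>I. ennreal (f n)) = ennreal (g n)" for n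
  proof (rule SUP_eqI)
    fix y assume y: "\<And>f. f \<in> I \<Longrightarrow> ennreal (f n) \<le> y"
    show "ennreal (g n) \<le> y"
    proof (cases y)
      case (real r)
      have "f n \<le> r" if "f \<in> I" for f using y[OF that] real by simp
      then have "g n \<le> r" unfolding g_def by (intro cSUP_least[OF I0])
      then show ?thesis using real by (simp add: ennreal_leI)
    qed simp
  qed (simp add: fg ennreal_leI)
  then have "ennreal (w n) * ennreal (a n) = (SUP f\<in>I. ennreal (w n) * ennreal (f n))" for n
    unfolding ag SUP_mult_left_ennreal[symmetric] by simp
  then have "diag_trace w A = (\<Sum>n. SUP f\<in>I. ennreal (w n) * ennreal (f n))"
    by (simp add: a(1))
  also have "\<dots> = (SUP f\<in>I. \<Sum>n. ennreal (w n) * ennreal (f n))"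
  proof (rule ennreal_suminf_SUP_eq_directed)
    fix N and f h :: "nat \<Rightarrow> real" assume fh: "f \<in> I" "h \<in> I"
    then obtain k where k: "k \<in> I" "op_le ell2 (rdiag f) (rdiag k)" "op_le ell2 (rdiag h) (rdiag k)"
      using dir by (auto simp: op_directed_def SI)
    then have "f n \<le> k n" "h n \<le> k n" for n using fh I by (auto simp: rdiag_le_iff)
    then show "\<exists>k\<in>I. \<forall>n\<in>N. ennreal (w n) * ennreal (f n) \<le> ennreal (w n) * ennreal (k n) \<and>
        ennreal (w n) * ennreal (h n) \<le> ennreal (w n) * ennreal (k n)"
      using k(1) by (auto intro!: bexI[of _ k] mult_left_mono ennreal_leI)
  qed
  also have "\<dots> = (SUP D\<in>S. diag_trace w D)" by (simp add: SI image_comp)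
  finally show "diag_trace w A = (SUP D\<in>S. diag_trace w D)" .
qed

lemma fns_diag_trace: "fns_trace ell2 diag_algebra (diag_trace w)"
  unfolding fns_trace_def
  using trace_on_diag_trace faithful_diag_trace normal_diag_trace semifinite_diag_trace by blast

end

section \<open>The spectral measure of a real diagonal operator\<close>

definition diag_spec :: "(nat \<Rightarrow> real) \<Rightarrow> real set \<Rightarrow> (nat \<Rightarrow> complex) \<Rightarrow> nat \<Rightarrow> complex" where
  "diag_spec f = (\<lambda>B\<in>sets borel. rdiag (\<lambda>n. indicator B (f n)))"

lemma bounded_range_indicator: "bounded (range (\<lambda>n. indicator B (f n) :: real))"
  by (rule boundedI[of _ 1]) (auto simp: indicator_def)

text \<open>
  The measure \<open>\<Sum>n. \<bar>x\<^sub>n\<bar>\<^sup>2 \<delta>\<^bsub>f n\<^esub>\<close>, written as an image measure so that the transformation rules for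
  integrals apply.
\<close>

definition diag_scalar_measure :: "(nat \<Rightarrow> real) \<Rightarrow> (nat \<Rightarrow> complex) \<Rightarrow> real measure" where
  "diag_scalar_measure f x =
     distr (density (count_space UNIV) (\<lambda>n. ennreal ((cmod (x n))\<^sup>2))) borel f"

lemma sets_diag_scalar_measure [simp]: "sets (diag_scalar_measure f x) = sets borel"
  and space_diag_scalar_measure [simp]: "space (diag_scalar_measure f x) = UNIV"
  by (simp_all add: diag_scalar_measure_def)

lemma emeasure_diag_scalar_measure:
  assumes x: "x \<in> carrier ell2" and B: "B \<in> sets borel"
  shows "emeasure (diag_scalar_measure f x) B = ennreal (Re (ip ell2 (diag_spec f B x) x))"
proof -
  have s: "(\<lambda>n. indicator B (f n) * (cmod (x n))\<^sup>2) sums Re (ip ell2 (diag_spec f B x) x)"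
    using ip_rdiag(1)[OF bounded_range_indicator x] B by (simp add: diag_spec_def)
  have "emeasure (diag_scalar_measure f x) B
      = (\<Sum>n. ennreal ((cmod (x n))\<^sup>2) * indicator (f -` B) n)"
    using B by (simp add: diag_scalar_measure_def emeasure_distr emeasure_density
        nn_integral_count_space_nat)
  also have "\<dots> = (\<Sum>n. ennreal (indicator B (f n) * (cmod (x n))\<^sup>2))"
    by (intro suminf_cong) (simp add: indicator_def)
  also have "\<dots> = ennreal (Re (ip ell2 (diag_spec f B x) x))"
    using s by (subst suminf_ennreal2) (auto simp: sums_iff)
  finally show ?thesis .
qed

lemma scalar_measure_diag_spec:
  assumes x: "x \<in> carrier ell2"
  shows "scalar_measure ell2 (diag_spec f) x = diag_scalar_measure f x"
proof -
  let ?M = "diag_scalar_measure f x"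
  have "scalar_measure ell2 (diag_spec f) x = measure_of UNIV (sets borel) (emeasure ?M)"
    unfolding scalar_measure_def
  proof (rule measure_of_eq)
    fix B :: "real set" assume "B \<in> sigma_sets UNIV (sets borel)"
    then have "B \<in> sets borel" using sets.sigma_sets_eq[of "borel :: real measure"] by simp
    then show "ennreal (Re (ip ell2 (diag_spec f B x) x)) = emeasure ?M B"
      using emeasure_diag_scalar_measure[OF x] by simp
  qed simp
  also have "\<dots> = ?M" using measure_of_of_measure[of ?M] by simp
  finally show ?thesis .
qed

lemma spectral_measure_diag_spec: "spectral_measure ell2 (diag_spec f)"
  unfolding spectral_measure_def
proof (intro conjI ballI)
  have b: "bounded (range (\<lambda>n. complex_of_real (indicator B (f n))))" for B
    by (simp only: bounded_range_of_real bounded_range_indicator)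
  have mult: "op_mult ell2 (rdiag (\<lambda>n. indicator B (f n))) (rdiag (\<lambda>n. indicator C (f n)))
      = rdiag (\<lambda>n. indicator (B \<inter> C) (f n))" for B C
    by (simp add: op_mult_diag[OF b] indicator_inter_arith)
  show "diag_spec f \<in> sets borel \<rightarrow>\<^sub>E projections ell2"
    using mult by (auto simp: diag_spec_def projections_def diag_bounded_op b adj_diag)
  show "diag_spec f UNIV = op_id ell2" by (simp add: diag_spec_def op_id_diag)
  show "diag_spec f (B \<inter> C) = op_mult ell2 (diag_spec f B) (diag_spec f C)"
    if "B \<in> sets borel" "C \<in> sets borel" for B C
    using that mult by (simp add: diag_spec_def)
  show "countably_additive (sets borel) (\<lambda>B. ennreal (Re (ip ell2 (diag_spec f B x) x)))"
    if x: "x \<in> carrier ell2" for x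
    using emeasure_countably_additive[of "diag_scalar_measure f x"] emeasure_diag_scalar_measure[OF x, of _ f]
    unfolding countably_additive_def by (auto simp: subset_eq)
qed

lemma op_integral_diag_spec:
  assumes g: "g \<in> borel_measurable borel" and b: "bounded (range (\<lambda>n. g (f n)))"
  shows "op_integral ell2 (diag_spec f) g (rdiag (\<lambda>n. g (f n)))"
  unfolding op_integral_def
proof (intro conjI ballI)
  show "rdiag (\<lambda>n. g (f n)) \<in> bounded_ops ell2"
    by (simp add: diag_bounded_op bounded_range_of_real b)
  fix x assume x: "x \<in> carrier ell2"
  let ?N = "density (count_space UNIV) (\<lambda>n. ennreal ((cmod (x n))\<^sup>2))"
  have f: "f \<in> measurable ?N borel" by simp
  obtain C where C: "\<And>n. \<bar>g (f n)\<bar> \<le> C" using b by (auto simp: bounded_iff)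
  have "summable (\<lambda>n. norm ((cmod (x n))\<^sup>2 *\<^sub>R g (f n)))"
  proof (rule summable_comparison_test)
    show "summable (\<lambda>n. (cmod (x n))\<^sup>2 * C)" using x by (simp add: mem_ell2_iff summable_mult2)
    show "\<exists>N. \<forall>n\<ge>N. norm (norm ((cmod (x n))\<^sup>2 *\<^sub>R g (f n))) \<le> (cmod (x n))\<^sup>2 * C"
      by (auto simp: abs_mult intro!: mult_left_mono C)
  qed
  then have int: "integrable (count_space UNIV) (\<lambda>n. (cmod (x n))\<^sup>2 *\<^sub>R g (f n))"
    by (simp only: integrable_count_space_nat_iff)
  then have "integrable ?N (\<lambda>n. g (f n))"
    by (subst integrable_density) auto
  then show "integrable (scalar_measure ell2 (diag_spec f) x) g"
    unfolding scalar_measure_diag_spec[OF x] diag_scalar_measure_def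
    by (subst integrable_distr_eq[OF f g])
  have "(\<integral>s. g s \<partial>scalar_measure ell2 (diag_spec f) x) = (\<integral>n. g (f n) \<partial>?N)"
    unfolding scalar_measure_diag_spec[OF x] diag_scalar_measure_def by (rule integral_distr[OF f g])
  also have "\<dots> = (\<integral>n. (cmod (x n))\<^sup>2 *\<^sub>R g (f n) \<partial>count_space UNIV)"
    by (rule integral_density) auto
  also have "\<dots> = (\<Sum>n. g (f n) * (cmod (x n))\<^sup>2)"
    by (subst integral_count_space_nat[OF int]) (simp add: mult.commute)
  finally show "ip ell2 (rdiag (\<lambda>n. g (f n)) x) x
      = complex_of_real (\<integral>s. g s \<partial>scalar_measure ell2 (diag_spec f) x)"
    using ip_rdiag(2)[OF b x] by simp
qed

section \<open>Uniqueness of the spectral measure\<close>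

context
  fixes E :: "real set \<Rightarrow> (nat \<Rightarrow> complex) \<Rightarrow> nat \<Rightarrow> complex"
  assumes E: "spectral_measure ell2 E"
begin

lemma spectral_projection:
  assumes "B \<in> sets borel"
  shows "E B \<in> bounded_ops ell2"
    and "x \<in> carrier ell2 \<Longrightarrow> y \<in> carrier ell2 \<Longrightarrow> ip ell2 (E B x) y = ip ell2 x (E B y)"
proof -
  have p: "E B \<in> projections ell2" using E assms unfolding spectral_measure_def by blast
  then show "E B \<in> bounded_ops ell2" by (simp add: projections_def)
  then show "x \<in> carrier ell2 \<Longrightarrow> y \<in> carrier ell2 \<Longrightarrow> ip ell2 (E B x) y = ip ell2 x (E B y)"
    using ip_adj[of "E B" x y] p by (simp add: projections_def)
qed

lemma spectral_Int:
  assumes "B \<in> sets borel" "C \<in> sets borel" "x \<in> carrier ell2"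
  shows "E B (E C x) = E (B \<inter> C) x"
  using E assms by (simp add: spectral_measure_def compose_def)

lemma spectral_UNIV: "x \<in> carrier ell2 \<Longrightarrow> E UNIV x = x"
  using E by (simp add: spectral_measure_def op_id_def)

lemma ip_spectral:
  assumes "B \<in> sets borel" "x \<in> carrier ell2"
  shows "ip ell2 (E B x) x = complex_of_real ((hnorm ell2 (E B x))\<^sup>2)"
proof -
  have c: "E B x \<in> carrier ell2" using bounded_ops_ell2D(1)[OF spectral_projection(1)] assms by blast
  have "ip ell2 (E B (E B x)) x = ip ell2 (E B x) (E B x)"
    by (rule spectral_projection(2)[OF assms(1) c assms(2)])
  then show ?thesis using ip_self_hnorm[OF c] by (simp add: spectral_Int assms)
qed

lemma sets_scalar_measure [measurable_cong, simp]: "sets (scalar_measure ell2 E x) = sets borel"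
  and space_scalar_measure [simp]: "space (scalar_measure ell2 E x) = UNIV"
  using sets.sigma_sets_eq[of "borel :: real measure"] by (simp_all add: scalar_measure_def)

lemma emeasure_scalar_measure:
  assumes B: "B \<in> sets borel" and x: "x \<in> carrier ell2"
  shows "emeasure (scalar_measure ell2 E x) B = ennreal ((hnorm ell2 (E B x))\<^sup>2)"
proof -
  let ?m = "\<lambda>B. ennreal (Re (ip ell2 (E B x) x))"
  have m: "?m B = ennreal ((hnorm ell2 (E B x))\<^sup>2)" if "B \<in> sets borel" for B
    using ip_spectral[OF that x] by simp
  have ca: "countably_additive (sets borel) ?m" using E x by (simp add: spectral_measure_def)
  \<comment> \<open>Countable additivity of a finite-valued set function already gives \<open>0\<close> at the empty set.\<close>
  have "(\<Sum>i::nat. ?m {}) = ?m {}"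
    using ca[unfolded countably_additive_def, rule_format, of "\<lambda>_. {}"]
    by (simp add: disjoint_family_on_def)
  then have "(\<Sum>i::nat. ennreal ((hnorm ell2 (E {} x))\<^sup>2)) \<noteq> \<infinity>"
    unfolding m[OF sets.empty_sets] by simp
  then have "summable (\<lambda>i::nat. (hnorm ell2 (E {} x))\<^sup>2)" by (intro summable_suminf_not_top) (auto simp: infinity_ennreal_def)
  then have "?m {} = 0" by (simp add: m summable_const_iff)
  then have "positive (sets borel) ?m" by (simp add: positive_def)
  then show ?thesis
    unfolding scalar_measure_def m[OF B, symmetric]
    using B ca sets.sigma_algebra_axioms[of "borel :: real measure"]
    by (intro emeasure_measure_of_sigma) auto
qed

lemma finite_scalar_measure:
  assumes "x \<in> carrier ell2"
  shows "finite_measure (scalar_measure ell2 E x)"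
  by (rule finite_measureI) (simp add: emeasure_scalar_measure assms)

lemma spectral_eq_0_iff:
  assumes B: "B \<in> sets borel" and x: "x \<in> carrier ell2"
  shows "emeasure (scalar_measure ell2 E x) B = 0 \<longleftrightarrow> E B x = (\<lambda>n. 0)"
proof -
  have c: "E B x \<in> carrier ell2" using bounded_ops_ell2D(1)[OF spectral_projection(1)] assms by blast
  show ?thesis
  proof
    assume "emeasure (scalar_measure ell2 E x) B = 0"
    then have "hnorm ell2 (E B x) = 0" using emeasure_scalar_measure[OF B x] by simp
    then show "E B x = (\<lambda>n. 0)" using cmod_le_hnorm[OF c] by (auto simp: fun_eq_iff)
  next
    assume "E B x = (\<lambda>n. 0)"
    then show "emeasure (scalar_measure ell2 E x) B = 0"
      using emeasure_scalar_measure[OF B x] by (simp add: hnorm_def ip_ell2)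
  qed
qed

lemma scalar_measure_spectral:
  assumes C: "C \<in> sets borel" and x: "x \<in> carrier ell2"
  shows "scalar_measure ell2 E (E C x) = density (scalar_measure ell2 E x) (indicator C)"
proof (rule measure_eqI)
  fix B assume "B \<in> sets (scalar_measure ell2 E (E C x))"
  then have B: "B \<in> sets borel" by simp
  have c: "E C x \<in> carrier ell2" using bounded_ops_ell2D(1)[OF spectral_projection(1)] C x by blast
  show "emeasure (scalar_measure ell2 E (E C x)) B
      = emeasure (density (scalar_measure ell2 E x) (indicator C)) B"
    using B C by (simp add: emeasure_density emeasure_scalar_measure c x spectral_Int
        indicator_inter_arith[symmetric] Int_commute del: indicator_inter_arith)
qed simp

text \<open>
  The defect \<open>d = x - E C x - E (- C) x\<close> is annihilated by \<open>E C\<close> and by \<open>E (- C)\<close>, so its scalar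
  measure vanishes on all of \<open>\<real>\<close>, that is, \<open>\<parallel>d\<parallel> = 0\<close>.
\<close>

lemma spectral_compl:
  assumes C: "C \<in> sets borel" and x: "x \<in> carrier ell2"
  shows "E (- C) x = (\<lambda>n. x n - E C x n)"
proof -
  have C': "- C \<in> sets borel" using C by (rule borel_comp)
  note Ec = bounded_ops_ell2D(1)[OF spectral_projection(1)]
  have empty: "E {} y = (\<lambda>n. 0)" if "y \<in> carrier ell2" for y
    using spectral_eq_0_iff[OF _ that, of "{}"] by simp
  let ?d = "\<lambda>n. (x n - E C x n) - E (- C) x n"
  have d: "?d \<in> carrier ell2" by (intro ell2_diff x Ec C C')
  have "E C ?d = (\<lambda>n. 0)" "E (- C) ?d = (\<lambda>n. 0)"
    using C C' x
    by (simp_all add: bounded_ops_ell2_diff[OF spectral_projection(1)] Ec ell2_diff spectral_Int empty)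
  then have "emeasure (scalar_measure ell2 E ?d) C = 0" "emeasure (scalar_measure ell2 E ?d) (- C) = 0"
    using spectral_eq_0_iff C C' d by blast+
  then have "emeasure (scalar_measure ell2 E ?d) (C \<union> - C) = 0"
    using plus_emeasure[of C "scalar_measure ell2 E ?d" "- C"] C C' by simp
  then have "?d = (\<lambda>n. 0)"
    using spectral_eq_0_iff[OF _ d, of UNIV] spectral_UNIV[OF d] by simp
  then show ?thesis by (auto simp: fun_eq_iff)
qed

text \<open>
  Let \<open>A\<close> be the diagonal operator, \<open>e\<close> its eigenvector with eigenvalue \<open>\<lambda> = f n\<close>, and \<open>\<nu>\<close> the scalar
  measure of \<open>e\<close>.  Split \<open>e = u + v\<close> with \<open>u = E C e\<close>.  The scalar measures of \<open>u\<close> and \<open>v\<close> are the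
  restrictions of \<open>\<nu>\<close> to \<open>C\<close> and its complement, whence
  \<open>\<langle>A e, e\<rangle> = \<langle>A u, u\<rangle> + \<langle>A v, v\<rangle>\<close> and \<open>Re \<langle>A u, v\<rangle> = 0\<close>.  Therefore
  \<open>\<integral>\<^sub>C s d\<nu> = \<langle>A u, u\<rangle> = Re \<langle>A u, e\<rangle> = \<lambda> \<nu> C\<close>, so \<open>s - \<lambda>\<close> has integral \<open>0\<close> over \<open>C\<close>.  If it has a
  constant strict sign there, given by \<open>\<sigma>\<close>, then \<open>\<nu> C = 0\<close>.
\<close>

lemma eigenvector_no_mass_on_one_side:
  assumes f: "bounded (range f)" and int: "op_integral ell2 E (\<lambda>s. s) (rdiag f)"
    and C: "C \<in> sets borel" and \<sigma>: "\<And>s. s \<in> C \<Longrightarrow> 0 < \<sigma> * (s - f n)"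
  shows "AE s in scalar_measure ell2 E (unit_vec n). s \<notin> C"
proof -
  define e where "e = unit_vec n"
  define u where "u = E C e"
  define v where "v = E (- C) e"
  let ?A = "rdiag f" and ?\<nu> = "scalar_measure ell2 E e"
  have e: "e \<in> carrier ell2" by (simp add: e_def)
  have C': "- C \<in> sets borel" using C by (rule borel_comp)
  note Ec = bounded_ops_ell2D(1)[OF spectral_projection(1)]
  have u: "u \<in> carrier ell2" and v: "v \<in> carrier ell2" using Ec C C' e by (auto simp: u_def v_def)
  have euv: "e = (\<lambda>n. u n + v n)" using spectral_compl[OF C e] by (simp add: u_def v_def)
  have A: "?A \<in> bounded_ops ell2" by (simp add: diag_bounded_op bounded_range_of_real f)
  note Ac = bounded_ops_ell2D(1)[OF A]
  have sa: "ip ell2 (?A x) y = ip ell2 x (?A y)" if "x \<in> carrier ell2" "y \<in> carrier ell2" for x y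
    using that by (simp add: ip_ell2 mult_ac)
  have ii: "integrable (scalar_measure ell2 E x) (\<lambda>s. s)"
    "Re (ip ell2 (?A x) x) = (\<integral>s. s \<partial>scalar_measure ell2 E x)" if "x \<in> carrier ell2" for x
    using int that by (auto simp: op_integral_def simp del: diag_apply)
  have part: "integrable ?\<nu> (\<lambda>s. indicator D s *\<^sub>R s)"
    "Re (ip ell2 (?A (E D e)) (E D e)) = (\<integral>s. indicator D s *\<^sub>R s \<partial>?\<nu>)" if D: "D \<in> sets borel" for D
  proof -
    show "integrable ?\<nu> (\<lambda>s. indicator D s *\<^sub>R s)"
      using D ii(1)[OF e] by (intro integrable_mult_indicator) auto
    have "(\<integral>s. s \<partial>scalar_measure ell2 E (E D e)) = (\<integral>s. s \<partial>density ?\<nu> (\<lambda>s. ennreal (indicator D s)))"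
      by (simp add: scalar_measure_spectral[OF D e] ennreal_indicator)
    also have "\<dots> = (\<integral>s. indicator D s *\<^sub>R s \<partial>?\<nu>)"
      by (rule integral_density) (use D in auto)
    finally show "Re (ip ell2 (?A (E D e)) (E D e)) = (\<integral>s. indicator D s *\<^sub>R s \<partial>?\<nu>)"
      using ii(2)[OF Ec[OF D e]] by simp
  qed
  have "Re (ip ell2 (?A e) e) = (\<integral>s. indicator C s *\<^sub>R s + indicator (- C) s *\<^sub>R s \<partial>?\<nu>)"
    unfolding ii(2)[OF e] by (intro Bochner_Integration.integral_cong) (auto simp: indicator_def)
  also have "\<dots> = Re (ip ell2 (?A u) u) + Re (ip ell2 (?A v) v)"
    unfolding u_def v_def part(2)[OF C] part(2)[OF C']
    by (rule Bochner_Integration.integral_add[OF part(1)[OF C] part(1)[OF C']])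
  finally have "Re (ip ell2 (?A e) e) = Re (ip ell2 (?A u) u) + Re (ip ell2 (?A v) v)" .
  moreover have "ip ell2 (?A e) e = ip ell2 (?A u) u + ip ell2 (?A v) v + ip ell2 (?A u) v + ip ell2 (?A v) u"
    unfolding euv bounded_ops_ell2D(2)[OF A u v]
    by (simp add: ip_add_left_ell2 ip_add_right_ell2 Ac u v del: diag_apply)
  moreover have "ip ell2 (?A v) u = cnj (ip ell2 (?A u) v)"
    using sa[OF v u] ip_cnj_ell2[OF Ac[OF u] v] by simp
  ultimately have cross: "Re (ip ell2 (?A u) v) = 0" by simp
  have "ip ell2 (?A u) e = ip ell2 u (\<lambda>k. complex_of_real (f n) * e k)"
    unfolding sa[OF u e] by (simp only: e_def diag_unit_vec)
  also have "\<dots> = complex_of_real (f n) * ip ell2 u e"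
    by (simp only: ip_smult_right_ell2[OF e u] complex_cnj_complex_of_real)
  also have "ip ell2 u e = complex_of_real (measure ?\<nu> C)"
    unfolding u_def ip_spectral[OF C e] by (simp add: measure_def emeasure_scalar_measure[OF C e])
  finally have "Re (ip ell2 (?A u) e) = f n * measure ?\<nu> C" by simp
  moreover have "ip ell2 (?A u) e = ip ell2 (?A u) u + ip ell2 (?A u) v"
    using ip_add_right_ell2[OF u v Ac[OF u]] by (simp add: euv[symmetric] del: diag_apply)
  ultimately have Iu: "(\<integral>s. indicator C s *\<^sub>R s \<partial>?\<nu>) = f n * measure ?\<nu> C"
    using cross part(2)[OF C] by (simp add: u_def del: diag_apply)
  interpret finite_measure ?\<nu> by (rule finite_scalar_measure[OF e])
  have ic: "integrable ?\<nu> (\<lambda>s. indicator C s :: real)" using C by (simp add: integrable_indicator_iff emeasure_finite less_top[symmetric])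
  let ?h = "\<lambda>s. \<sigma> * (indicator C s *\<^sub>R s - indicator C s * f n)"
  have ih: "integrable ?\<nu> ?h"
    using part(1)[OF C] ic by (intro integrable_mult_right Bochner_Integration.integrable_diff integrable_mult_left)
  have "(\<integral>s. ?h s \<partial>?\<nu>) = 0"
    using part(1)[OF C] ic C Iu by (simp add: mult.commute)
  moreover have "?h s \<ge> 0" for s using \<sigma>[of s] by (auto simp: indicator_def)
  ultimately have "AE s in ?\<nu>. ?h s = 0" using integral_nonneg_eq_0_iff_AE[OF ih] by auto
  then show ?thesis
    unfolding e_def by (rule eventually_mono) (use \<sigma> in \<open>force simp: indicator_def split: if_splits\<close>)
qed

text \<open>
  Applying the previous lemma to both sides of \<open>f n\<close> shows that \<open>E B e\<^sub>n\<close> is \<open>e\<^sub>n\<close> or \<open>0\<close> according to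
  whether \<open>f n \<in> B\<close>.  Self-adjointness of \<open>E B\<close> turns this into its coordinates at every vector.
\<close>

lemma spectral_measure_unique:
  assumes f: "bounded (range f)" and int: "op_integral ell2 E (\<lambda>s. s) (rdiag f)"
  shows "E = diag_spec f"
proof -
  have B0: "E B (unit_vec n) = (\<lambda>k. 0)" if B: "B \<in> sets borel" and n: "f n \<notin> B" for B n
  proof -
    have "AE s in scalar_measure ell2 E (unit_vec n). s \<notin> {f n<..}"
      "AE s in scalar_measure ell2 E (unit_vec n). s \<notin> {..<f n}"
      using eigenvector_no_mass_on_one_side[OF f int, of "{f n<..}" 1 n]
        eigenvector_no_mass_on_one_side[OF f int, of "{..<f n}" "-1" n] by auto
    then have "AE s in scalar_measure ell2 E (unit_vec n). s \<notin> B"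
      by eventually_elim (use n in \<open>metis greaterThan_iff lessThan_iff linorder_neqE\<close>)
    then show ?thesis
      using AE_iff_measurable[of B "scalar_measure ell2 E (unit_vec n)" "\<lambda>s. s \<notin> B"] B
        spectral_eq_0_iff[OF B unit_vec_ell2] by simp
  qed
  have Be: "E B (unit_vec n) = (\<lambda>k. indicator B (f n) * unit_vec n k)" if B: "B \<in> sets borel" for B n
  proof (cases "f n \<in> B")
    case True
    have "(\<lambda>k. unit_vec n k - E B (unit_vec n) k) = (\<lambda>k. 0)"
      using B0[of "- B" n] spectral_compl[OF B unit_vec_ell2, of n] B True by auto
    then have "unit_vec n k - E B (unit_vec n) k = 0" for k by (rule fun_cong)
    then show ?thesis using True by (auto simp: fun_eq_iff)
  qed (use B0[OF B] in simp)
  have "E B = rdiag (\<lambda>n. indicator B (f n))" if B: "B \<in> sets borel" for B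
  proof (rule ops_eqI)
    fix x n assume x: "x \<in> carrier ell2"
    have "E B x n = ip ell2 x (E B (unit_vec n))"
      using spectral_projection(2)[OF B x unit_vec_ell2] by simp
    also have "\<dots> = indicator B (f n) * x n"
      unfolding Be[OF B] ip_smult_right_ell2[OF unit_vec_ell2 x] by (simp add: indicator_def)
    finally show "E B x n = rdiag (\<lambda>n. indicator B (f n)) x n"
      using x by (simp add: indicator_def)
  qed (use spectral_projection(1)[OF B] bounded_ops_ell2D(4) in auto)
  moreover have "E \<in> extensional (sets borel)" using E by (auto simp: spectral_measure_def PiE_def)
  ultimately show ?thesis
    by (intro extensionalityI[of E "sets borel"]) (auto simp: diag_spec_def)
qed

end

section \<open>Functional calculus and singular numbers\<close>

lemma spectral_measure_of_rdiag:
  assumes "bounded (range f)"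
  shows "spectral_measure_of ell2 (rdiag f) = diag_spec f"
  unfolding spectral_measure_of_def
proof (rule the_equality)
  show "spectral_measure ell2 (diag_spec f) \<and> op_integral ell2 (diag_spec f) (\<lambda>s. s) (rdiag f)"
    using spectral_measure_diag_spec op_integral_diag_spec[of "\<lambda>s. s" f] assms by simp
qed (use spectral_measure_unique[OF _ assms] in blast)

lemma op_fun_rdiag:
  assumes f: "bounded (range f)" and g: "g \<in> borel_measurable borel" "bounded (range (\<lambda>n. g (f n)))"
  shows "op_fun ell2 g (rdiag f) = rdiag (\<lambda>n. g (f n))"
  unfolding op_fun_def spectral_measure_of_rdiag[OF f]
proof (rule the_equality)
  show int: "op_integral ell2 (diag_spec f) g (rdiag (\<lambda>n. g (f n)))"
    by (rule op_integral_diag_spec[OF g])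
  fix B assume "op_integral ell2 (diag_spec f) g B"
  with int show "B = rdiag (\<lambda>n. g (f n))"
    by (intro op_eq_of_quadratic_form) (auto simp: op_integral_def)
qed

lemma op_powr_rdiag:
  assumes f: "bounded (range f)" "\<And>n. 0 \<le> f n" and a: "0 \<le> a"
  shows "op_powr ell2 (rdiag f) a = rdiag (\<lambda>n. f n powr a)"
  unfolding op_powr_def
proof (rule op_fun_rdiag[OF f(1)])
  obtain C where "\<And>n. \<bar>f n\<bar> \<le> C" using f(1) by (auto simp: bounded_iff)
  then show "bounded (range (\<lambda>n. f n powr a))"
    using f(2) a by (intro boundedI[of _ "C powr a"]) (auto intro!: powr_mono2)
qed measurable

lemma op_abs_rdiag:
  assumes f: "bounded (range f)" "\<And>n. 0 \<le> f n"
  shows "op_abs ell2 (rdiag f) = rdiag f"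
proof -
  have b: "bounded (range (\<lambda>n. complex_of_real (f n)))" by (simp add: bounded_range_of_real f)
  obtain C where C: "\<And>n. \<bar>f n\<bar> \<le> C" using f(1) by (auto simp: bounded_iff)
  have b2: "bounded (range (\<lambda>n. f n * f n))"
    using f(2) C by (intro boundedI[of _ "C * C"]) (auto simp: abs_mult intro!: mult_mono order_trans[OF f(2)])
  have "op_mult ell2 (adj ell2 (rdiag f)) (rdiag f) = rdiag (\<lambda>n. f n * f n)"
    by (simp add: adj_diag b op_mult_diag)
  moreover have "(f n * f n) powr (1/2) = f n" for n using f(2) by (simp add: powr_half_sqrt)
  moreover have "op_powr ell2 (rdiag (\<lambda>n. f n * f n)) (1/2) = rdiag (\<lambda>n. (f n * f n) powr (1/2))"
    by (rule op_powr_rdiag[OF b2]) (use f(2) in auto)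
  ultimately show ?thesis unfolding op_abs_def by (simp only:)
qed

lemma singular_number_rdiag:
  assumes f: "bounded (range f)" "\<And>n. 0 \<le> f n"
  shows "singular_number ell2 (diag_trace w) (rdiag f) t
    = Inf {s. 0 \<le> s \<and> (\<Sum>n. ennreal (w n) * indicator {s<..} (f n)) \<le> ennreal t}"
  unfolding singular_number_def
  by (simp add: op_abs_rdiag f spectral_measure_of_rdiag diag_spec_def ennreal_indicator)

section \<open>The sparse eigenvalue sequence\<close>

definition eigenvalue :: "nat \<Rightarrow> real" where
  "eigenvalue k = exp (- (4 ^ k))"

definition weight :: "real \<Rightarrow> nat \<Rightarrow> real" where
  "weight p k = 2 ^ k * exp (p * 4 ^ k)"

lemma eigenvalue_pos: "0 < eigenvalue k"
  and eigenvalue_le_1: "eigenvalue k \<le> 1"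
  by (simp_all add: eigenvalue_def)

lemma bounded_eigenvalue: "bounded (range eigenvalue)"
  by (rule boundedI[of _ 1]) (use eigenvalue_pos eigenvalue_le_1 in \<open>auto simp: less_imp_le\<close>)

lemma weight_pos: "0 < weight p k"
  by (simp add: weight_def)

lemma weight_gt_1:
  assumes "0 < p"
  shows "1 < weight p k"
proof -
  have "1 * 1 < 2 ^ k * exp (p * 4 ^ k)"
    by (rule mult_le_less_imp_less) (use assms in auto)
  then show ?thesis by (simp add: weight_def)
qed

lemma weight_eigenvalue_powr_le:
  assumes "0 < \<epsilon>"
  shows "weight p k * eigenvalue k powr (p + \<epsilon>) \<le> (1 / \<epsilon>) * (1/2) ^ k"
proof -
  have "weight p k * eigenvalue k powr (p + \<epsilon>) = 2 ^ k * exp (- (\<epsilon> * 4 ^ k))"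
    by (simp add: weight_def eigenvalue_def powr_def mult.assoc exp_add[symmetric] algebra_simps)
  also have "\<dots> \<le> 2 ^ k * (1 / (\<epsilon> * 4 ^ k))"
  proof -
    have "\<epsilon> * 4 ^ k \<le> exp (\<epsilon> * 4 ^ k)"
      using exp_ge_add_one_self[of "\<epsilon> * 4 ^ k"] by linarith
    then have "exp (- (\<epsilon> * 4 ^ k)) \<le> 1 / (\<epsilon> * 4 ^ k)"
      unfolding exp_minus inverse_eq_divide using assms by (intro divide_left_mono) auto
    then show ?thesis by (rule mult_left_mono) simp
  qed
  also have "\<dots> = (1 / \<epsilon>) * (1/2) ^ k"
    using power_mult_distrib[of "2::real" 2 k] by (simp add: power_divide)
  finally show ?thesis .
qed

text \<open>
  The weight cancels \<open>\<lambda>\<^sub>k\<^sup>p\<close> exactly up to the factor \<open>2\<^sup>k\<close>, leaving \<open>\<Sum>k. 2\<^sup>k exp (- \<epsilon> 4\<^sup>k)\<close>, which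
  \<open>exp (- y) \<le> 1 / y\<close> bounds by a geometric series.
\<close>

lemma trace_powr_le:
  assumes "0 < \<epsilon>" "0 < p"
  shows "diag_trace (weight p) (op_powr ell2 (rdiag eigenvalue) (p + \<epsilon>)) \<le> ennreal (2 / \<epsilon>)"
proof -
  have "diag_trace (weight p) (op_powr ell2 (rdiag eigenvalue) (p + \<epsilon>))
      = (\<Sum>k. ennreal (weight p k * eigenvalue k powr (p + \<epsilon>)))"
    using assms weight_pos
    by (simp add: op_powr_rdiag[OF bounded_eigenvalue] eigenvalue_pos less_imp_le ennreal_mult')
  also have "\<dots> \<le> (\<Sum>k. ennreal ((1 / \<epsilon>) * (1/2) ^ k))"
    using assms by (intro suminf_le ennreal_leI weight_eigenvalue_powr_le summableI)
  also have "\<dots> = ennreal ((1 / \<epsilon>) * 2)"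
    using sums_mult[OF geometric_sums[of "1/2 :: real"], of "1 / \<epsilon>"] assms
    by (intro suminf_ennreal_eq) auto
  finally show ?thesis by simp
qed

text \<open>
  The atom of mass \<open>w\<^sub>k\<close> at \<open>\<lambda>\<^sub>k\<close> alone makes \<open>\<tau> (E (\<sigma>, \<infinity>))\<close> exceed \<open>s\<close> whenever \<open>\<sigma> < \<lambda>\<^sub>k\<close>.
\<close>

lemma singular_number_ge_eigenvalue:
  assumes "0 \<le> s" "s < weight p k"
  shows "eigenvalue k \<le> singular_number ell2 (diag_trace (weight p)) (rdiag eigenvalue) s"
  unfolding singular_number_rdiag[OF bounded_eigenvalue less_imp_le[OF eigenvalue_pos]]
proof (rule cInf_greatest)
  let ?S = "{\<sigma>. 0 \<le> \<sigma> \<and> (\<Sum>n. ennreal (weight p n) * indicator {\<sigma><..} (eigenvalue n)) \<le> ennreal s}"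
  have "eigenvalue n \<notin> {1<..}" for n using eigenvalue_le_1[of n] by simp
  then have "1 \<in> ?S" by simp
  then show "?S \<noteq> {}" by blast
  fix \<sigma> assume \<sigma>: "\<sigma> \<in> ?S"
  show "eigenvalue k \<le> \<sigma>"
  proof (rule ccontr)
    assume "\<not> eigenvalue k \<le> \<sigma>"
    then have "ennreal (weight p k) = (\<Sum>n\<in>{k}. ennreal (weight p n) * indicator {\<sigma><..} (eigenvalue n))"
      by simp
    also have "\<dots> \<le> (\<Sum>n. ennreal (weight p n) * indicator {\<sigma><..} (eigenvalue n))"
      by (rule sum_le_suminf) auto
    also have "\<dots> \<le> ennreal s" using \<sigma> by simp
    finally show False using assms by simp
  qed
qed

text \<open>
  The integral up to \<open>t = w\<^sub>k\<close> is at least \<open>w\<^sub>k \<lambda>\<^sub>k\<close>; as \<open>w\<^sub>k > 1\<close>, dividing by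
  \<open>\<psi>\<^sub>p (w\<^sub>k) = w\<^sub>k\<^bsup>1 - 1/p\<^esup>\<close> leaves \<open>w\<^sub>k\<^bsup>1/p\<^esup> \<lambda>\<^sub>k = 2\<^bsup>k/p\<^esup>\<close>.
\<close>

lemma weak_schatten_quotient_ge:
  assumes "1 < p"
  shows "ennreal ((2 powr (1/p)) ^ k) \<le> ennreal (1 / psi p (weight p k)) *
    (\<integral>\<^sup>+s\<in>{0..weight p k}. ennreal (singular_number ell2 (diag_trace (weight p)) (rdiag eigenvalue) s) \<partial>lborel)"
proof -
  let ?t = "weight p k"
  have t: "1 < ?t" using weight_gt_1 assms by simp
  have psi: "psi p ?t = ?t powr (1 - 1/p)" "0 < psi p ?t" using t by (auto simp: psi_def)
  have "(2 powr (1/p)) ^ k = ?t powr (1/p) * eigenvalue k"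
  proof -
    have "?t powr (1/p) = (2 ^ k) powr (1/p) * exp (p * 4 ^ k) powr (1/p)"
      by (simp add: weight_def powr_mult)
    also have "exp (p * 4 ^ k) powr (1/p) = exp (4 ^ k)"
      using assms by (simp add: powr_def)
    also have "(2 ^ k) powr (1/p) = (2 powr (1/p)) ^ k"
      by (simp add: powr_realpow[symmetric] powr_powr mult.commute)
    finally show ?thesis by (simp add: eigenvalue_def exp_minus)
  qed
  also have "?t powr (1/p) = (1 / psi p ?t) * ?t"
    using t by (simp add: psi(1) powr_diff)
  finally have "ennreal ((2 powr (1/p)) ^ k) = ennreal (1 / psi p ?t) * (ennreal (eigenvalue k) * ennreal ?t)"
    using psi(2) t eigenvalue_pos[of k] by (simp add: ennreal_mult[symmetric] mult_ac)
  also have "ennreal (eigenvalue k) * ennreal ?t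
      = (\<integral>\<^sup>+s. ennreal (eigenvalue k) * indicator {0..<?t} s \<partial>lborel)"
    using t by (subst nn_integral_cmult_indicator) auto
  also have "\<dots> \<le> (\<integral>\<^sup>+s\<in>{0..?t}. ennreal (singular_number ell2 (diag_trace (weight p)) (rdiag eigenvalue) s) \<partial>lborel)"
    by (intro nn_integral_mono)
      (auto simp: indicator_def intro!: ennreal_leI singular_number_ge_eigenvalue)
  finally show ?thesis by (simp add: mult_left_mono)
qed

lemma not_weak_schatten:
  assumes "1 < p"
  shows "rdiag eigenvalue \<notin> weak_schatten ell2 diag_algebra (diag_trace (weight p)) p"
proof
  let ?q = "\<lambda>t. ennreal (1 / psi p t) *
    (\<integral>\<^sup>+s\<in>{0..t}. ennreal (singular_number ell2 (diag_trace (weight p)) (rdiag eigenvalue) s) \<partial>lborel)"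
  assume "rdiag eigenvalue \<in> weak_schatten ell2 diag_algebra (diag_trace (weight p)) p"
  then have fin: "(SUP t\<in>{0<..}. ?q t) < \<infinity>" by (simp add: weak_schatten_def)
  then obtain c where c: "0 \<le> c" "(SUP t\<in>{0<..}. ?q t) = ennreal c"
    by (cases "SUP t\<in>{0<..}. ?q t") auto
  have "(2 powr (1/p)) ^ k \<le> c" for k
  proof -
    have "ennreal ((2 powr (1/p)) ^ k) \<le> ?q (weight p k)"
      by (rule weak_schatten_quotient_ge[OF assms])
    also have "\<dots> \<le> ennreal c"
      unfolding c(2)[symmetric] by (rule SUP_upper) (simp add: weight_pos)
    finally show ?thesis using c(1) by simp
  qed
  moreover have "1 < 2 powr (1/p)" using assms by simp
  then obtain k where "c < (2 powr (1/p)) ^ k" using real_arch_pow by blast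
  ultimately show False by (meson not_le)
qed

theorem proposition4p9:
  fixes p :: real
  assumes "p > 1"
  shows "\<exists>(H :: (nat \<Rightarrow> complex) inner_product_space) N \<tau> T.
    hilbert_space H \<and> semifinite_von_neumann_algebra H N \<and> fns_trace H N \<tau> \<and>
    T \<in> pos_part H N \<and>
    (SUP r\<in>{1::real..}. ennreal (1 / r) * \<tau> (op_powr H T (p + 1 / r))) < \<infinity> \<and>
    T \<notin> weak_schatten H N \<tau> p"
proof (intro exI conjI)
  let ?\<tau> = "diag_trace (weight p)" and ?T = "rdiag eigenvalue"
  show "hilbert_space ell2" by (rule hilbert_space_ell2)
  show fns: "fns_trace ell2 diag_algebra ?\<tau>" by (rule fns_diag_trace[OF weight_pos])
  then show "semifinite_von_neumann_algebra ell2 diag_algebra"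
    using von_neumann_diag_algebra by (auto simp: semifinite_von_neumann_algebra_def)
  show "?T \<in> pos_part ell2 diag_algebra"
    using bounded_eigenvalue eigenvalue_pos by (auto simp: pos_part_diag_algebra less_imp_le)
  have "ennreal (1 / r) * ?\<tau> (op_powr ell2 ?T (p + 1 / r)) \<le> ennreal 2" if "r \<in> {1..}" for r
  proof -
    have r: "0 < r" using that by simp
    have "ennreal (1 / r) * ?\<tau> (op_powr ell2 ?T (p + 1 / r)) \<le> ennreal (1 / r) * ennreal (2 / (1 / r))"
      using r assms by (intro mult_left_mono trace_powr_le) auto
    also have "\<dots> = ennreal 2" using r by (simp add: ennreal_mult[symmetric])
    finally show ?thesis .
  qed
  then have "(SUP r\<in>{1::real..}. ennreal (1 / r) * ?\<tau> (op_powr ell2 ?T (p + 1 / r))) \<le> ennreal 2"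
    by (rule SUP_least)
  then show "(SUP r\<in>{1::real..}. ennreal (1 / r) * ?\<tau> (op_powr ell2 ?T (p + 1 / r))) < \<infinity>"
    by (rule order.strict_trans1) simp
  show "?T \<notin> weak_schatten ell2 diag_algebra ?\<tau> p" by (rule not_weak_schatten[OF assms])
qed

end
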